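(* Let $\hat{\mathbb{G}}$ be $\hat{\mathbb{R}}$, $\hat{\mathbb{C}}$ or $\hat{\mathbb{Q}}$ (dual numbers, dual complex numbers, or dual quaternions), and let $\Phi=(G,\hat{\mathbb{G}},\varphi)$ be a gain graph with underlying graph $G=(V,E)$, $n=|V|$, $m=|E|$. Suppose that $|\varphi(e_{ij})|=1$ for all $(i,j)\in E$, and that $G$ has $t$ connected components $G_i=(V_i,E_i)$, $i=1,\dots,t$, with $n=n_1+\cdots+n_t$, $n_0=0$, and $V_i=\{n_1+\cdots+n_{i-1}+1,\dots,n_1+\cdots+n_i\}$. Let $L$ be the Laplacian matrix of $\Phi$. Then $\Phi$ is balanced if and only if the following conditions hold simultaneously: (i) $L$ has $t$ zero eigenvalues that are the smallest eigenvalue of $L$; (ii) their eigenvectors $\mathbf{x}_i\in\hat{\mathbb{G}}^n$ ($i=1,\dots,t$) satisfy $|x_i(j)|=\frac{\sqrt{n_i}}{n_i}$ for $j=n_1+\cdots+n_{i-1}+1,\dots,n_1+\cdots+n_i$, and $|x_i(j)|=0$ otherwise; (iii) $Y^*LY$ is equal to the Laplacian matrix of the underlying graph $G$, where $Y=\mathrm{diag}(\mathbf{y})\in\hat{\mathbb{G}}^{n\times n}$, $\mathbf{x}_a=\mathbf{x}_1+\cdots+\mathbf{x}_t$, and $y(i)=\frac{x_a(i)}{|x_a(i)|}$ for $i=1,\dots,n$. Here (ii) and (iii) are understood as: there exist eigenvectors $\mathbf{x}_1,\dots,\mathbf{x}_t$ of $L$ for the eigenvalue $0$ with the property in (ii),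 and (iii) holds for the $Y$ built from these same eigenvectors.
   Context: For $\mathbb{G}\in\{\mathbb{R},\mathbb{C},\mathbb{Q}\}$ ($\mathbb{Q}$ the real quaternions), $\hat{\mathbb{G}}=\{a_s+a_d\epsilon : a_s,a_d\in\mathbb{G}\}$ with $\epsilon^2=0$, $\epsilon\ne0$, $\epsilon$ commuting with $\mathbb{G}$. Conjugation: $(a_s+a_d\epsilon)^*=a_s^*+a_d^*\epsilon$; $A^*$ is the conjugate transpose of a matrix. The magnitude of $a=a_s+a_d\epsilon$ is the dual number $|a|=|a_s|+\frac{a_sa_d^*+a_da_s^*}{2|a_s|}\epsilon$ if $a_s\neq0$, and $|a|=|a_d|\epsilon$ otherwise. Dual numbers (elements of $\hat{\mathbb{R}}$) are totally ordered by: $a>b$ iff $a_s>b_s$, or $a_s=b_s$ and $a_d>b_d$. A gain graph $\Phi=(G,\hat{\mathbb{G}},\varphi)$ consists of a finite simple undirected graph $G=(V,E)$, $V=\{1,\dots,n\}$, each edge being considered in both orientations $e_{ij}$, $e_{ji}$, and a gain function $\varphi$ assigning to each oriented edge an invertible element of $\hat{\mathbb{G}}$ with $\varphi(e_{ij})=\varphi(e_{ji})^{-1}$. When $|\varphi(e_{ij})|=1$ for all edges it is a unit gain graph, and then $\varphi(e_{ji})=\varphi(e_{ij})^*$. $\Phi$ is balanced if for every cycle $j_1,\dots,j_k,j_{k+1}=j_1$ of $G$ one has $\prod_{i=1}^k\varphi(e_{j_ij_{i+1}})=1$ (product in order). The adjacency matrix $A(\Phi)=(a_{ij})\in\hat{\mathbb{G}}^{n\times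 n}$ has $a_{ij}=\varphi(e_{ij})$ if $e_{ij}$ is an edge and $a_{ij}=0$ otherwise; the Laplacian matrix is $L=L(\Phi)=D-A(\Phi)$, where $D$ is the diagonal degree matrix of $G$. The Laplacian matrix of the underlying graph $G$ is $D$ minus the usual $0$-$1$ adjacency matrix. For a unit gain graph, $L$ is dual Hermitian ($L^*=L$). $\lambda$ is an eigenvalue of a dual Hermitian $L$ with eigenvector $\mathbf{x}=\mathbf{x}_s+\mathbf{x}_d\epsilon\in\hat{\mathbb{G}}^n$ if $\mathbf{x}_s\neq\mathbf{0}$ and $L\mathbf{x}=\mathbf{x}\lambda$; such $\lambda$ are dual numbers, and an $n\times n$ dual Hermitian matrix has exactly $n$ of them counted with multiplicity (there is $U$ with $U^*U=UU^*=I$ and $U^*LU=\mathrm{diag}(\lambda_1,\dots,\lambda_n)$, the $\lambda_i$ unique up to order). Condition (i) means that the smallest eigenvalue of $L$ is $0$ and that it has multiplicity $t$. $x(j)$ denotes the $j$-th component of $\mathbf{x}$. *)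

theory Defs
  imports
    "HOL-Analysis.Inner_Product"
    "Jordan_Normal_Form.Matrix"
    "Graph_Theory.Pair_Digraph"
    "Graph_Theory.Digraph_Component"
begin

section \<open>The scalar domains: real numbers, complex numbers, quaternions\<close>

text \<open>The common interface of the three domains. Conjugation reverses products, since
  multiplication need not commute; \<open>real_part x\<close> is \<open>(x + conjugate x) / 2\<close> read as
  a real number.\<close>

class gain_scalar = real_normed_div_algebra + conjugate +
  fixes real_part :: "'a \<Rightarrow> real"
  assumes conjugate_scalar_add: "conjugate (x + y) = conjugate x + conjugate y"
    and conjugate_scalar_mult: "conjugate (x * y) = conjugate y * conjugate x"
    and scaleR_real_part: "(2 * real_part x) *\<^sub>R 1 = x + conjugate x"
    and mult_conjugate_norm: "x * conjugate x = (norm x)\<^sup>2 *\<^sub>R 1"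

instantiation real :: gain_scalar
begin
definition real_part_real :: "real \<Rightarrow> real" where "real_part_real x = x"
instance
  by standard (simp_all add: real_part_real_def power2_eq_square)
end

instantiation complex :: gain_scalar
begin
definition real_part_complex :: "complex \<Rightarrow> real" where "real_part_complex = Re"
instance
proof
  fix x y :: complex
  show "conjugate (x + y) = conjugate x + conjugate y"
    "conjugate (x * y) = conjugate y * conjugate x"
    by simp_all
  show "(2 * real_part x) *\<^sub>R 1 = x + conjugate x"
    by (simp add: real_part_complex_def complex_eq_iff)
  show "x * conjugate x = (norm x)\<^sup>2 *\<^sub>R 1"
    using complex_norm_square[of x] by (simp add: scaleR_conv_of_real)
qed
end

datatype quat = Quat (qre: real) (qi: real) (qj: real) (qk: real)

lemma quat_eq_iff:
  "x = y \<longleftrightarrow> qre x = qre y \<and> qi x = qi y \<and> qj x = qj y \<and> qk x = qk y"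
  by (auto intro: quat.expand)

instantiation quat :: real_inner
begin

definition "0 = Quat 0 0 0 0"
definition "x + y = Quat (qre x + qre y) (qi x + qi y) (qj x + qj y) (qk x + qk y)"
definition "- x = Quat (- qre x) (- qi x) (- qj x) (- qk x)"
definition "x - y = Quat (qre x - qre y) (qi x - qi y) (qj x - qj y) (qk x - qk y)"
definition "scaleR r x = Quat (r * qre x) (r * qi x) (r * qj x) (r * qk x)"
definition "inner x y = qre x * qre y + qi x * qi y + qj x * qj y + qk x * qk y"
definition "norm (x :: quat) = sqrt (inner x x)"
definition "sgn (x :: quat) = scaleR (inverse (norm x)) x"
definition "dist x y = norm (x - y :: quat)"
definition [code del]:
  "(uniformity :: (quat \<times> quat) filter) = (INF e\<in>{0<..}. principal {(x, y). dist x y < e})"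
definition [code del]:
  "open (U :: quat set) \<longleftrightarrow> (\<forall>x\<in>U. eventually (\<lambda>(x', y). x' = x \<longrightarrow> y \<in> U) uniformity)"

lemmas quat_linear_defs = zero_quat_def plus_quat_def uminus_quat_def minus_quat_def
  scaleR_quat_def inner_quat_def

instance
proof
  fix x y z :: quat and r s :: real
  show "x + y + z = x + (y + z)" "x + y = y + x" "0 + x = x" "- x + x = 0" "x - y = x + - y"
    "scaleR r (x + y) = scaleR r x + scaleR r y" "scaleR (r + s) x = scaleR r x + scaleR s x"
    "scaleR r (scaleR s x) = scaleR (r * s) x" "scaleR 1 x = x"
    "inner x y = inner y x" "inner (x + y) z = inner x z + inner y z"
    "inner (scaleR r x) y = r * inner x y"
    by (simp_all add: quat_linear_defs algebra_simps)
  show "0 \<le> inner x x" by (simp add: inner_quat_def)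
  show "inner x x = 0 \<longleftrightarrow> x = 0"
    by (simp add: quat_linear_defs quat_eq_iff add_nonneg_eq_0_iff)
  show "norm x = sqrt (inner x x)" by (rule norm_quat_def)
  show "sgn x = scaleR (inverse (norm x)) x" by (rule sgn_quat_def)
  show "dist x y = norm (x - y)" by (rule dist_quat_def)
  show "(uniformity :: (quat \<times> quat) filter) = (INF e\<in>{0<..}. principal {(x, y). dist x y < e})"
    by (rule uniformity_quat_def)
  show "open U \<longleftrightarrow> (\<forall>x\<in>U. eventually (\<lambda>(x', y). x' = x \<longrightarrow> y \<in> U) uniformity)" for U :: "quat set"
    by (rule open_quat_def)
qed

end

instantiation quat :: real_normed_div_algebra
begin

definition "1 = Quat 1 0 0 0"
definition "x * y = Quat
  (qre x * qre y - qi x * qi y - qj x * qj y - qk x * qk y)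
  (qre x * qi y + qi x * qre y + qj x * qk y - qk x * qj y)
  (qre x * qj y - qi x * qk y + qj x * qre y + qk x * qi y)
  (qre x * qk y + qi x * qj y - qj x * qi y + qk x * qre y)"
definition "inverse x =
  scaleR (inverse ((norm x)\<^sup>2)) (Quat (qre x) (- qi x) (- qj x) (- qk x))"
definition "x div y = x * inverse (y :: quat)"

lemma norm_quat_power2: "(norm (x :: quat))\<^sup>2 = (qre x)\<^sup>2 + (qi x)\<^sup>2 + (qj x)\<^sup>2 + (qk x)\<^sup>2"
  by (simp add: norm_quat_def inner_quat_def power2_eq_square)

instance
proof
  fix x y z :: quat and r :: real
  show "x * y * z = x * (y * z)" "1 * x = x" "x * 1 = x" "(x + y) * z = x * z + y * z"
    "x * (y + z) = x * y + x * z" "scaleR r x * y = scaleR r (x * y)"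
    "x * scaleR r y = scaleR r (x * y)"
    by (simp_all add: quat_linear_defs one_quat_def times_quat_def algebra_simps)
  show "(0 :: quat) \<noteq> 1" by (simp add: zero_quat_def one_quat_def)
  show "x div y = x * inverse y" by (rule divide_quat_def)
  show "inverse (0 :: quat) = 0" by (simp add: inverse_quat_def quat_linear_defs)
  have c: "x * Quat (qre x) (- qi x) (- qj x) (- qk x) = scaleR ((norm x)\<^sup>2) 1"
    "Quat (qre x) (- qi x) (- qj x) (- qk x) * x = scaleR ((norm x)\<^sup>2) 1"
    unfolding norm_quat_power2
    by (simp_all add: times_quat_def one_quat_def scaleR_quat_def power2_eq_square algebra_simps)
  have sc: "x * scaleR r y = scaleR r (x * y)" "scaleR r x * y = scaleR r (x * y)"
    for x y :: quat and r
    by (simp_all add: scaleR_quat_def times_quat_def algebra_simps)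
  show "x \<noteq> 0 \<Longrightarrow> inverse x * x = 1" "x \<noteq> 0 \<Longrightarrow> x * inverse x = 1"
    by (simp_all add: inverse_quat_def c sc)
  have "(norm (x * y))\<^sup>2 = (norm x * norm y)\<^sup>2"
    unfolding power_mult_distrib norm_quat_power2
    by (simp add: times_quat_def power2_eq_square algebra_simps)
  then show "norm (x * y) = norm x * norm y"
    by (simp add: power2_eq_iff_nonneg)
qed

end

instantiation quat :: gain_scalar
begin

definition "conjugate x = Quat (qre x) (- qi x) (- qj x) (- qk x)"
definition "real_part x = qre x"

instance
proof
  fix x y :: quat
  show "conjugate (conjugate x) = x" "conjugate x = conjugate y \<longleftrightarrow> x = y"
    "conjugate (x + y) = conjugate x + conjugate y"
    "conjugate (x * y) = conjugate y * conjugate x"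
    "(2 * real_part x) *\<^sub>R 1 = x + conjugate x"
    "x * conjugate x = (norm x)\<^sup>2 *\<^sub>R 1"
    unfolding norm_quat_power2
    by (auto simp: conjugate_quat_def real_part_quat_def scaleR_quat_def one_quat_def
        plus_quat_def times_quat_def quat_eq_iff power2_eq_square algebra_simps)
qed

end


section \<open>Dual numbers over a scalar domain\<close>

text \<open>\<open>Dual a b\<close> stands for \<open>a + b\<epsilon>\<close>.\<close>

datatype 'a dual = Dual (std_part: 'a) (dual_part: 'a)

lemma dual_eq_iff: "x = y \<longleftrightarrow> std_part x = std_part y \<and> dual_part x = dual_part y"
  by (auto intro: dual.expand)

instantiation dual :: (ring_1) ring_1
begin

definition "0 = Dual 0 0"
definition "1 = Dual 1 0"
definition "x + y = Dual (std_part x + std_part y) (dual_part x + dual_part y)"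
definition "- x = Dual (- std_part x) (- dual_part x)"
definition "x - y = Dual (std_part x - std_part y) (dual_part x - dual_part y)"
definition "x * y = Dual (std_part x * std_part y)
  (std_part x * dual_part y + dual_part x * std_part y)"

instance
proof
  fix x y z :: "'a dual"
  note defs = zero_dual_def one_dual_def plus_dual_def uminus_dual_def minus_dual_def
    times_dual_def
  show "x + y + z = x + (y + z)" "x + y = y + x" "0 + x = x" "- x + x = 0" "x - y = x + - y"
    "1 * x = x" "x * 1 = x" "(0 :: 'a dual) \<noteq> 1"
    by (simp_all only: defs dual.sel dual.inject dual.collapse) (simp_all add: add.assoc add.commute)
  show "x * y * z = x * (y * z)" "(x + y) * z = x * z + y * z" "x * (y + z) = x * y + x * z"
    by (simp_all only: defs dual.sel dual.inject distrib_left distrib_right mult.assoc add.assoc)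
      (simp_all only: add.commute add.left_commute)
qed

end

text \<open>The invertible elements are those with nonzero standard part; as usual, the inverse of
  all other elements is set to \<open>0\<close>.\<close>

instantiation dual :: (division_ring) inverse
begin

definition "inverse x = (if std_part x = 0 then 0 else
  Dual (inverse (std_part x)) (- (inverse (std_part x) * dual_part x * inverse (std_part x))))"
definition "x div y = x * inverse (y :: 'a dual)"

instance ..

end

lemma dual_inverse:
  fixes x :: "'a :: division_ring dual"
  assumes "std_part x \<noteq> 0"
  shows "x * inverse x = 1" "inverse x * x = 1"
  using assms
  by (simp_all add: inverse_dual_def times_dual_def one_dual_def mult.assoc[symmetric])
     (simp add: mult.assoc)

instantiation dual :: (gain_scalar) conjugate
begin

definition "conjugate x = Dual (conjugate (std_part x)) (conjugate (dual_part x))"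

instance
  by standard (auto simp: conjugate_dual_def dual_eq_iff)

end

instantiation dual :: (linorder) linorder
begin

definition "x \<le> y \<longleftrightarrow>
  std_part x < std_part y \<or> std_part x = std_part y \<and> dual_part x \<le> dual_part y"
definition "x < y \<longleftrightarrow>
  std_part x < std_part y \<or> std_part x = std_part y \<and> dual_part x < dual_part y"

instance
  by standard (auto simp: less_eq_dual_def less_dual_def dual_eq_iff)

end

definition of_dual :: "real dual \<Rightarrow> 'a :: gain_scalar dual" where
  "of_dual x = Dual (of_real (std_part x)) (of_real (dual_part x))"

text \<open>The numerator \<open>a\<^sub>s a\<^sub>d\<^sup>* + a\<^sub>d a\<^sub>s\<^sup>*\<close> is self-conjugate, so
  taking its real part only changes its type.\<close>

definition magnitude :: "'a :: gain_scalar dual \<Rightarrow> real dual" where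
  "magnitude a =
    (if std_part a \<noteq> 0
     then Dual (norm (std_part a))
       (real_part (std_part a * conjugate (dual_part a) + dual_part a * conjugate (std_part a))
         / (2 * norm (std_part a)))
     else Dual 0 (norm (dual_part a)))"


section \<open>Matrices and eigenvalues\<close>

text \<open>The constants \<open>mat_adjoint\<close>, \<open>eigenvector\<close> and \<open>eigenvalue\<close> of the Jordan normal form
  library are confined to commutative scalars.\<close>

definition conj_transpose :: "'a :: conjugate mat \<Rightarrow> 'a mat" where
  "conj_transpose A = mat (dim_col A) (dim_row A) (\<lambda>(i, j). conjugate (A $$ (j, i)))"

definition right_eigenvector ::
    "'a :: gain_scalar dual mat \<Rightarrow> 'a dual vec \<Rightarrow> 'a dual \<Rightarrow> bool" where
  "right_eigenvector L x \<mu> \<longleftrightarrow>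
    x \<in> carrier_vec (dim_row L) \<and> (\<exists>j < dim_row L. std_part (x $ j) \<noteq> 0) \<and>
    L *\<^sub>v x = map_vec (\<lambda>a. a * \<mu>) x"

definition right_eigenvalue :: "'a :: gain_scalar dual mat \<Rightarrow> 'a dual \<Rightarrow> bool" where
  "right_eigenvalue L \<mu> \<longleftrightarrow> (\<exists>x. right_eigenvector L x \<mu>)"

definition smallest_eigenvalue :: "'a :: gain_scalar dual mat \<Rightarrow> real dual \<Rightarrow> bool" where
  "smallest_eigenvalue L l \<longleftrightarrow>
    right_eigenvalue L (of_dual l) \<and>
    (\<forall>\<mu>. right_eigenvalue L \<mu> \<longrightarrow> (\<exists>m. \<mu> = of_dual m \<and> l \<le> m))"

text \<open>\<open>\<Lambda>\<close> lists the eigenvalues of the dual Hermitian matrix \<open>L\<close> with multiplicity;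
  it is determined by \<open>L\<close> up to order.\<close>

definition eigenvalue_list :: "'a :: gain_scalar dual mat \<Rightarrow> real dual list \<Rightarrow> bool" where
  "eigenvalue_list L \<Lambda> \<longleftrightarrow>
    (let n = dim_row L in
      length \<Lambda> = n \<and>
      (\<exists>U \<in> carrier_mat n n.
        conj_transpose U * U = 1\<^sub>m n \<and> U * conj_transpose U = 1\<^sub>m n \<and>
        conj_transpose U * L * U = mat_diag n (\<lambda>i. of_dual (\<Lambda> ! i))))"

definition eigenvalue_multiplicity ::
    "'a :: gain_scalar dual mat \<Rightarrow> real dual \<Rightarrow> nat \<Rightarrow> bool" where
  "eigenvalue_multiplicity L l k \<longleftrightarrow> (\<exists>\<Lambda>. eigenvalue_list L \<Lambda> \<and> count_list \<Lambda> l = k)"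


section \<open>Gain graphs\<close>

text \<open>A finite simple undirected graph is a \<^locale>\<open>pair_graph\<close>: a finite loopfree symmetric
  set of vertex pairs, so that each edge occurs in both orientations. The matrices below
  presuppose the vertex set \<open>{0..<n}\<close>.\<close>

definition gain_graph ::
    "'v pair_pre_digraph \<Rightarrow> ('v \<times> 'v \<Rightarrow> 'a :: gain_scalar dual) \<Rightarrow> bool" where
  "gain_graph G \<phi> \<longleftrightarrow> pair_graph G \<and>
    (\<forall>(u, v) \<in> parcs G. \<phi> (u, v) * \<phi> (v, u) = 1 \<and> \<phi> (v, u) * \<phi> (u, v) = 1)"

definition unit_gain_graph ::
    "'v pair_pre_digraph \<Rightarrow> ('v \<times> 'v \<Rightarrow> 'a :: gain_scalar dual) \<Rightarrow> bool" where
  "unit_gain_graph G \<phi> \<longleftrightarrow> gain_graph G \<phi> \<and> (\<forall>e \<in> parcs G. magnitude (\<phi> e) = 1)"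

text \<open>In a symmetric digraph the library's cycles include the walks of length two that
  traverse an edge back and forth; the bound on the length excludes them.\<close>

definition balanced ::
    "'v pair_pre_digraph \<Rightarrow> ('v \<times> 'v \<Rightarrow> 'a :: gain_scalar dual) \<Rightarrow> bool" where
  "balanced G \<phi> \<longleftrightarrow>
    (\<forall>p. pre_digraph.cycle (with_proj G) p \<and> 3 \<le> length p \<longrightarrow> prod_list (map \<phi> p) = 1)"

definition gain_adjacency ::
    "nat pair_pre_digraph \<Rightarrow> (nat \<times> nat \<Rightarrow> 'a :: ring_1) \<Rightarrow> 'a mat" where
  "gain_adjacency G \<phi> = mat (card (pverts G)) (card (pverts G))
    (\<lambda>e. if e \<in> parcs G then \<phi> e else 0)"

definition degree_matrix :: "nat pair_pre_digraph \<Rightarrow> 'a :: ring_1 mat" where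
  "degree_matrix G = mat_diag (card (pverts G)) (\<lambda>i. of_nat (out_degree (with_proj G) i))"

definition gain_laplacian ::
    "nat pair_pre_digraph \<Rightarrow> (nat \<times> nat \<Rightarrow> 'a :: ring_1) \<Rightarrow> 'a mat" where
  "gain_laplacian G \<phi> = degree_matrix G - gain_adjacency G \<phi>"

definition graph_laplacian :: "nat pair_pre_digraph \<Rightarrow> 'a :: ring_1 mat" where
  "graph_laplacian G = degree_matrix G -
    mat (card (pverts G)) (card (pverts G)) (\<lambda>e. if e \<in> parcs G then 1 else 0)"


section \<open>The three conditions\<close>

text \<open>\<open>block ns i\<close> is the \<open>i\<close>-th of the consecutive vertex intervals of lengths
  \<open>ns 1, ns 2, \<dots>\<close>, where \<open>ns 0 = 0\<close> and vertices are numbered from \<open>0\<close>.\<close>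

definition block :: "(nat \<Rightarrow> nat) \<Rightarrow> nat \<Rightarrow> nat set" where
  "block ns i = {(\<Sum>k<i. ns k)..<(\<Sum>k\<le>i. ns k)}"

definition zero_eigenvalue_condition :: "'a :: gain_scalar dual mat \<Rightarrow> nat \<Rightarrow> bool" where
  "zero_eigenvalue_condition L t \<longleftrightarrow> smallest_eigenvalue L 0 \<and> eigenvalue_multiplicity L 0 t"

definition eigenvector_condition ::
    "'a :: gain_scalar dual mat \<Rightarrow> nat \<Rightarrow> (nat \<Rightarrow> nat) \<Rightarrow> (nat \<Rightarrow> 'a dual vec) \<Rightarrow> bool" where
  "eigenvector_condition L t ns x \<longleftrightarrow>
    (\<forall>i \<in> {1..t}. right_eigenvector L (x i) 0 \<and>
      (\<forall>j < dim_row L. magnitude (x i $ j) =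
        (if j \<in> block ns i then Dual (sqrt (real (ns i)) / real (ns i)) 0 else 0)))"

definition switching_condition ::
    "nat pair_pre_digraph \<Rightarrow> 'a :: gain_scalar dual mat \<Rightarrow> nat \<Rightarrow> (nat \<Rightarrow> 'a dual vec) \<Rightarrow> bool"
  where
  "switching_condition G L t x \<longleftrightarrow>
    (let n = dim_row L;
         xa = vec n (\<lambda>j. \<Sum>i = 1..t. x i $ j);
         Y = mat_diag n (\<lambda>j. xa $ j / of_dual (magnitude (xa $ j)))
     in conj_transpose Y * L * Y = graph_laplacian G)"

end

theory Submission
  imports Defs "HOL-Analysis.Function_Topology" "Jordan_Normal_Form.Determinant"
begin

text \<open>A balanced gain function has a potential: a unit-valued \<open>\<theta>\<close> with
  \<open>\<phi> (u, v) = \<theta> u (\<theta> v)\<^sup>*\<close> on every arc. Conjugation by \<open>diag \<theta>\<close> then turns \<open>L\<close>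
  into the Laplacian \<open>L\<^sub>0\<close> of the underlying graph, so an orthonormal eigenbasis of the real
  symmetric matrix \<open>L\<^sub>0\<close>, started with the normalized indicators of the components,
  diagonalizes \<open>L\<close>; vectors in the kernel of \<open>L\<^sub>0\<close> are constant on components, so the indicators
  exhaust the zero eigenvalues. Conversely, the vector \<open>y\<close> of condition (iii) is such a
  potential, and gains that come from a potential telescope along cycles.\<close>

section \<open>Dual scalars\<close>

text \<open>The scalars need not commute and dual numbers have zero divisors, so no spectral theory
  is applied to \<open>L\<close> itself. The real eigenbasis is carried into the dual scalars by a
  homomorphism, and the multiplicity of 0 thereby becomes a statement about a real matrix. That 0 is
  the smallest eigenvalue concerns every right eigenvalue, a priori any dual scalar, and comes from
  a quadratic form instead. Units are handled by \<open>conjugate a * a = 1\<close>, which is stable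
  under products, in place of the two-case formula for the magnitude.\<close>

lemma conjugate_zero_scalar [simp]: "conjugate (0 :: 'a :: gain_scalar) = 0"
  using conjugate_scalar_add[of 0 "0 :: 'a"] by simp

lemma conjugate_minus_scalar [simp]: "conjugate (- x :: 'a :: gain_scalar) = - conjugate x"
  using conjugate_scalar_add[of x "- x"] by (simp add: eq_neg_iff_add_eq_0 add.commute)

lemma conjugate_of_real_scalar [simp]:
  "conjugate (of_real r :: 'a :: gain_scalar) = of_real r"
proof (cases "r = 0")
  case False
  have "of_real r * conjugate (of_real r :: 'a) = of_real r * of_real r"
    using mult_conjugate_norm[of "of_real r :: 'a"]
    by (simp add: power2_eq_square scaleR_conv_of_real abs_if split: if_splits)
  with False show ?thesis by simp
qed simp

lemma conjugate_one_scalar [simp]: "conjugate (1 :: 'a :: gain_scalar) = 1"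
  using conjugate_of_real_scalar[of 1] by simp

lemma norm_conjugate_scalar [simp]: "norm (conjugate x) = norm (x :: 'a :: gain_scalar)"
proof (cases "x = 0")
  case False
  have "norm x * norm (conjugate x) = (norm x)\<^sup>2"
    using mult_conjugate_norm[of x] by (simp flip: norm_mult)
  with False show ?thesis by (simp add: power2_eq_square)
qed simp

lemma conjugate_mult_norm: "conjugate x * x = (norm (x :: 'a :: gain_scalar))\<^sup>2 *\<^sub>R 1"
  using mult_conjugate_norm[of "conjugate x"] by simp

text \<open>Halving \<open>x + conjugate x = 2 x\<close>. It undoes the change of type made by
  \<open>real_part\<close>, so that real coefficients can be compared with the scalars they came
  from.\<close>

lemma self_conjugate_scalar:
  fixes x :: "'a :: gain_scalar"
  assumes "conjugate x = x"
  shows "of_real (real_part x) = x"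
proof -
  have "(2 :: real) *\<^sub>R (real_part x *\<^sub>R (1 :: 'a)) = 2 *\<^sub>R x"
    using scaleR_real_part[of x] assms by (simp add: scaleR_2)
  then show ?thesis
    by (metis of_real_def scaleR_left_imp_eq zero_neq_numeral)
qed

lemma real_part_zero [simp]: "real_part (0 :: 'a :: gain_scalar) = 0"
  using self_conjugate_scalar[of "0 :: 'a"] by simp

lemma of_real_central: "of_real r * x = x * (of_real r :: 'a :: real_algebra_1)"
  by (simp add: of_real_def)

section \<open>Componentwise arithmetic of dual scalars\<close>

lemma std_part_arith [simp]:
  "std_part 0 = 0" "std_part 1 = 1" "std_part (x + y) = std_part x + std_part y"
  "std_part (- x) = - std_part x" "std_part (x - y) = std_part x - std_part y"
  "std_part (x * y) = std_part x * std_part y"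
  by (simp_all add: zero_dual_def one_dual_def plus_dual_def uminus_dual_def minus_dual_def
      times_dual_def)

lemma dual_part_arith [simp]:
  "dual_part 0 = 0" "dual_part 1 = 0" "dual_part (x + y) = dual_part x + dual_part y"
  "dual_part (- x) = - dual_part x" "dual_part (x - y) = dual_part x - dual_part y"
  "dual_part (x * y) = std_part x * dual_part y + dual_part x * std_part y"
  by (simp_all add: zero_dual_def one_dual_def plus_dual_def uminus_dual_def minus_dual_def
      times_dual_def)

lemma dual_part_conjugate [simp]:
  "std_part (conjugate x) = conjugate (std_part x)"
  "dual_part (conjugate x) = conjugate (dual_part x)"
  by (simp_all add: conjugate_dual_def)

lemma dual_part_of_dual [simp]:
  "std_part (of_dual x) = of_real (std_part x)" "dual_part (of_dual x) = of_real (dual_part x)"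
  by (simp_all add: of_dual_def)

lemma conjugate_dual_arith:
  fixes x y :: "'a :: gain_scalar dual"
  shows "conjugate (x + y) = conjugate x + conjugate y" "conjugate (x * y) = conjugate y * conjugate x"
    "conjugate (- x) = - conjugate x" "conjugate (x - y) = conjugate x - conjugate y"
    "conjugate (0 :: 'a dual) = 0" "conjugate (1 :: 'a dual) = 1"
  using conjugate_scalar_add[of "std_part x" "- std_part y"]
    conjugate_scalar_add[of "dual_part x" "- dual_part y"]
  by (simp_all add: dual_eq_iff conjugate_scalar_add conjugate_scalar_mult add.commute)

lemma conjugate_of_dual [simp]: "conjugate (of_dual x) = of_dual x"
  by (simp add: dual_eq_iff)

lemma of_dual_arith:
  "of_dual 0 = 0" "of_dual 1 = 1" "of_dual (x + y) = of_dual x + of_dual y"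
  "of_dual (x * y) = of_dual x * of_dual y"
  by (simp_all add: dual_eq_iff)

lemma of_dual_sum: "of_dual (\<Sum>i\<in>I. f i) = (\<Sum>i\<in>I. of_dual (f i))"
  by (induction I rule: infinite_finite_induct) (simp_all add: of_dual_arith)

lemma of_dual_central: "of_dual x * a = a * of_dual x"
  by (simp add: dual_eq_iff of_real_central)

lemma mult_conjugate_scaled:
  "a * of_dual x * conjugate (a * of_dual x) = of_dual x * (a * conjugate a) * of_dual x"
proof -
  have "a * of_dual x * conjugate (a * of_dual x) = (a * of_dual x) * (of_dual x * conjugate a)"
    by (simp only: conjugate_dual_arith conjugate_of_dual)
  also have "\<dots> = (of_dual x * a) * (conjugate a * of_dual x)"
    by (simp only: of_dual_central[of x a] of_dual_central[of x "conjugate a"])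
  finally show ?thesis by (simp only: mult.assoc)
qed

lemma dual_of_nat: "(of_nat k :: 'a :: gain_scalar dual) = of_dual (Dual (real k) 0)"
  by (induction k) (simp_all add: dual_eq_iff)

section \<open>Magnitudes, units and normalization\<close>

lemma magnitude_eq_real_iff:
  fixes a :: "'a :: gain_scalar dual"
  assumes "r > 0"
  shows "magnitude a = Dual r 0 \<longleftrightarrow> a * conjugate a = of_dual (Dual (r\<^sup>2) 0)"
proof -
  let ?d = "std_part a * conjugate (dual_part a) + dual_part a * conjugate (std_part a)"
  have std: "std_part a * conjugate (std_part a) = of_real (r\<^sup>2) \<longleftrightarrow> norm (std_part a) = r"
    unfolding mult_conjugate_norm of_real_def using assms by simp
  \<comment> \<open>The numerator is self-conjugate, hence real, so it vanishes together with its
    real part. It is also the infinitesimal part of \<open>a * conjugate a\<close>, which links the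
    two sides.\<close>
  have "conjugate ?d = ?d"
    by (simp add: conjugate_scalar_add conjugate_scalar_mult)
  then have "of_real (real_part ?d) = ?d"
    by (rule self_conjugate_scalar)
  then have "real_part ?d = 0 \<longleftrightarrow> ?d = 0"
    by (metis of_real_0 of_real_eq_iff)
  then show ?thesis
    using assms std by (auto simp: magnitude_def dual_eq_iff)
qed

lemma magnitude_eq_zero_iff: "magnitude a = 0 \<longleftrightarrow> a = 0"
  by (auto simp: magnitude_def dual_eq_iff)

text \<open>A one-sided inverse forces a nonzero standard part; then \<open>inverse a\<close> is a
  two-sided inverse, and \<open>b\<close> must be equal to it. Both forms of the unit condition are
  thus interchangeable without commutativity.\<close>

lemma dual_left_inverse_right_inverse:
  fixes a b :: "'a :: gain_scalar dual"
  assumes "a * b = 1"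
  shows "b * a = 1"
proof -
  have "std_part a * std_part b = 1"
    using assms by (metis std_part_arith(2,6))
  then have "std_part a \<noteq> 0" by auto
  then have inv: "inverse a * a = 1" by (rule dual_inverse)
  then have "b = inverse a"
    using assms by (metis mult.assoc mult_1_left mult_1_right)
  with inv show ?thesis by simp
qed

lemma magnitude_eq_one_iff:
  fixes a :: "'a :: gain_scalar dual"
  shows "magnitude a = 1 \<longleftrightarrow> conjugate a * a = 1"
proof -
  have "magnitude a = 1 \<longleftrightarrow> a * conjugate a = 1"
    using magnitude_eq_real_iff[of 1 a] by (simp add: one_dual_def of_dual_def)
  then show ?thesis
    using dual_left_inverse_right_inverse by blast
qed

text \<open>Positivity of \<open>r\<close> excludes the non-invertible elements, for which the division
  returns the junk value \<open>0\<close>.\<close>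

lemma normalized_dual:
  fixes a :: "'a :: gain_scalar dual"
  assumes "magnitude a = Dual r 0" "r > 0"
  shows "conjugate (a / of_dual (magnitude a)) * (a / of_dual (magnitude a)) = 1"
proof -
  have inv: "inverse (of_dual (Dual r 0)) = (of_dual (Dual (inverse r) 0) :: 'a dual)"
    using assms(2) by (simp add: inverse_dual_def dual_eq_iff)
  let ?c = "of_dual (Dual (inverse r) 0) :: 'a dual"
  have "a * ?c * conjugate (a * ?c) = ?c * (a * conjugate a) * ?c"
    by (rule mult_conjugate_scaled)
  also have "a * conjugate a = of_dual (Dual (r\<^sup>2) 0)"
    using assms magnitude_eq_real_iff by blast
  also have "?c * of_dual (Dual (r\<^sup>2) 0) * ?c = of_dual (Dual (inverse r * r\<^sup>2 * inverse r) 0)"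
    by (simp add: dual_eq_iff)
  also have "inverse r * r\<^sup>2 * inverse r = 1"
    using assms(2) by (simp add: power2_eq_square field_simps)
  finally have "a * ?c * conjugate (a * ?c) = 1"
    by (simp add: dual_eq_iff)
  then show ?thesis
    unfolding divide_dual_def assms(1) inv by (rule dual_left_inverse_right_inverse)
qed

text \<open>The element \<open>conjugate a * a\<close> is self-conjugate, so both its coefficients
  are real; recording it as a real dual number makes the order available.\<close>

definition dual_normsq :: "'a :: gain_scalar dual \<Rightarrow> real dual" where
  "dual_normsq a = Dual ((norm (std_part a))\<^sup>2)
    (real_part (conjugate (std_part a) * dual_part a + conjugate (dual_part a) * std_part a))"

lemma of_dual_normsq: "of_dual (dual_normsq a) = conjugate a * a"
  unfolding dual_eq_iff dual_normsq_def
  by (auto simp: conjugate_mult_norm conjugate_scalar_add conjugate_scalar_mult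
      of_real_def[symmetric] intro!: self_conjugate_scalar)

lemma dual_normsq_nonneg: "0 \<le> dual_normsq a"
  by (auto simp: less_eq_dual_def dual_normsq_def)

text \<open>In the lexicographic order the standard part decides, and it is scaled by
  \<open>std_part p > 0\<close>. If it vanishes, the infinitesimal part of the product reduces to
  \<open>std_part p * dual_part m\<close>.\<close>

lemma dual_nonneg_cancel:
  fixes p m :: "real dual"
  assumes "std_part p > 0" "0 \<le> p * m"
  shows "0 \<le> m"
  using assms by (auto simp: less_eq_dual_def zero_less_mult_iff zero_le_mult_iff)

lemma dual_sum_nonneg:
  fixes f :: "'b \<Rightarrow> real dual"
  assumes "\<And>i. i \<in> I \<Longrightarrow> 0 \<le> f i"
  shows "0 \<le> sum f I"
  using assms
proof (induction I rule: infinite_finite_induct)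
  case (insert i I)
  then have "0 \<le> f i" "0 \<le> sum f I" by auto
  with insert.hyps show ?case by (auto simp: less_eq_dual_def)
qed auto

lemma std_part_sum: "std_part (\<Sum>i\<in>I. f i) = (\<Sum>i\<in>I. std_part (f i))"
  by (induction I rule: infinite_finite_induct) simp_all

text \<open>The reals as dual scalars without infinitesimal part; as a homomorphism it transports
  real matrix identities to the noncommutative setting.\<close>

definition real_dual :: "real \<Rightarrow> 'a :: gain_scalar dual" where
  "real_dual r = of_dual (Dual r 0)"

lemma conj_transpose_mult:
  fixes A B :: "'a :: gain_scalar dual mat"
  assumes "A \<in> carrier_mat k l" "B \<in> carrier_mat l m"
  shows "conj_transpose (A * B) = conj_transpose B * conj_transpose A"
proof -
  have conj_sum: "conjugate (sum f I) = (\<Sum>i\<in>I. conjugate (f i))" for f :: "nat \<Rightarrow> 'a dual" and I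
    by (induction I rule: infinite_finite_induct) (simp_all add: conjugate_dual_arith)
  show ?thesis
    using assms
    by (intro eq_matI)
      (auto simp: conj_transpose_def scalar_prod_def conj_sum conjugate_dual_arith intro!: sum.cong)
qed

section \<open>Orthonormal eigenbases of real symmetric matrices\<close>

text \<open>The vectors are the rows of a square matrix whose row \<open>k\<close> is replaced by 0.
  It is singular, and a kernel vector is orthogonal to the first \<open>k\<close> rows.\<close>

lemma exists_orthogonal_vector:
  fixes v :: "nat \<Rightarrow> nat \<Rightarrow> real"
  assumes "k < n"
  shows "\<exists>x. (\<exists>i<n. x i \<noteq> 0) \<and> (\<forall>j<k. (\<Sum>i<n. v j i * x i) = 0)"
proof -
  define A where "A = mat\<^sub>r n n (\<lambda>j. if j = k then 0\<^sub>v n else vec n (v j))"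
  have A: "A \<in> carrier_mat n n" by (simp add: A_def)
  have "det A = 0"
    unfolding A_def using assms by (intro det_row_0) auto
  then obtain x where x: "x \<in> carrier_vec n" "x \<noteq> 0\<^sub>v n" "A *\<^sub>v x = 0\<^sub>v n"
    using det_0_iff_vec_prod_zero_field[OF A] by blast
  have "\<exists>i<n. x $ i \<noteq> 0"
    using x(1,2) by (metis eq_vecI carrier_vecD dim_vec index_zero_vec(1) index_zero_vec(2))
  moreover have "(\<Sum>i<n. v j i * x $ i) = 0" if "j < k" for j
  proof -
    have "(A *\<^sub>v x) $ j = (\<Sum>i<n. v j i * x $ i)"
      using that assms x(1) A
      by (auto simp: A_def scalar_prod_def lessThan_atLeast0 intro!: sum.cong)
    with x(3) that assms show ?thesis by simp
  qed
  ultimately show ?thesis by blast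
qed

text \<open>The dimension \<open>n\<close> is a variable, so vectors are functions on all of
  \<open>nat\<close>; pinning the coordinates from \<open>n\<close> on to 0 makes the cube a product
  of compact sets, and Tychonoff's theorem applies.\<close>

lemma compact_cube:
  "compact {x :: nat \<Rightarrow> real. \<forall>i. x i \<in> (if i < n then {-1..1} else {0})}"
proof -
  have "compactin (product_topology (\<lambda>i. euclidean) UNIV)
      (PiE UNIV (\<lambda>i. if i < n then {-1..1} else {0 :: real}))"
    unfolding compactin_PiE by (auto simp: compactin_euclidean_iff)
  then show ?thesis
    by (simp add: euclidean_product_topology compactin_euclidean_iff PiE_UNIV_domain Pi_def)
qed

text \<open>A continuous function attains its maximum on a compact set of unit vectors. Quadratic
  form and squared norm are both homogeneous of degree 2, so maximality extends to all orthogonal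
  \<open>y\<close>, normalized or not.\<close>

lemma orthogonal_unit_maximizer:
  fixes A v :: "nat \<Rightarrow> nat \<Rightarrow> real"
  assumes "k < n"
  defines "q \<equiv> \<lambda>x. \<Sum>a<n. \<Sum>b<n. A a b * x a * x b"
  shows "\<exists>x. (\<Sum>i<n. x i * x i) = 1 \<and> (\<forall>j<k. (\<Sum>i<n. v j i * x i) = 0) \<and>
    (\<forall>y. (\<forall>j<k. (\<Sum>i<n. v j i * y i) = 0) \<longrightarrow> q y \<le> q x * (\<Sum>i<n. y i * y i))"
proof -
  define N where "N = (\<lambda>x :: nat \<Rightarrow> real. \<Sum>i<n. x i * x i)"
  define K where "K = {x :: nat \<Rightarrow> real. \<forall>i. x i \<in> (if i < n then {-1..1} else {0})}"
  define S where "S = K \<inter> {x. N x = 1} \<inter> (\<Inter>j\<in>{..<k}. {x. (\<Sum>i<n. v j i * x i) = 0})"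
  have cont: "continuous_on UNIV (\<lambda>x :: nat \<Rightarrow> real. x i)" for i
    by (rule continuous_on_product_coordinates)
  have "closed {x. N x = 1}"
    unfolding N_def by (intro closed_Collect_eq continuous_intros cont)
  moreover have "closed (\<Inter>j\<in>{..<k}. {x :: nat \<Rightarrow> real. (\<Sum>i<n. v j i * x i) = 0})"
    by (intro closed_INT ballI closed_Collect_eq continuous_intros cont)
  ultimately have S: "compact S"
    unfolding S_def K_def by (intro compact_Int_closed compact_cube)
  have normalize: "(\<lambda>i. if i < n then y i / sqrt (N y) else 0) \<in> S" (is "?z \<in> S")
      "q (\<lambda>i. if i < n then y i / sqrt (N y) else 0) = q y / N y"
    if y: "N y > 0" "\<forall>j<k. (\<Sum>i<n. v j i * y i) = 0" for y
  proof -
    have "N ?z = (\<Sum>i<n. y i * y i / N y)"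
      unfolding N_def using y(1) by (intro sum.cong) (auto simp: N_def)
    also have "\<dots> = 1"
      using y(1) by (simp add: N_def flip: sum_divide_distrib)
    finally have N1: "N ?z = 1" .
    have "?z i \<in> {-1..1}" if "i < n" for i
    proof -
      have "?z i * ?z i \<le> N ?z"
        unfolding N_def
        by (rule member_le_sum[of i "{..<n}" "\<lambda>i. ?z i * ?z i", unfolded N_def])
          (use that in auto)
      with N1 have "(?z i)\<^sup>2 \<le> 1" by (simp only: power2_eq_square)
      then have "\<bar>?z i\<bar> \<le> 1" by (simp only: abs_square_le_1)
      then have "?z i \<le> 1 \<and> - ?z i \<le> 1" by (simp only: abs_le_iff)
      then show ?thesis unfolding atLeastAtMost_iff by linarith
    qed
    then have "?z \<in> K" by (simp add: K_def)
    moreover have "(\<Sum>i<n. v j i * ?z i) = 0" if "j < k" for j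
    proof -
      have "(\<Sum>i<n. v j i * ?z i) = (\<Sum>i<n. v j i * y i) / sqrt (N y)"
        unfolding sum_divide_distrib by (intro sum.cong) auto
      with y(2) that show ?thesis by simp
    qed
    ultimately show "?z \<in> S" using N1 by (auto simp: S_def)
    have "A a b * ?z a * ?z b = A a b * y a * y b / N y" if "a < n" "b < n" for a b
      using that y(1) by (simp add: field_simps)
    then show "q ?z = q y / N y"
      unfolding q_def sum_divide_distrib by (intro sum.cong) auto
  qed
  have N_pos: "N y > 0" if "i < n" "y i \<noteq> 0" for y i
  proof -
    have "0 < y i * y i" using that(2) by (simp add: zero_less_mult_iff) linarith
    also have "\<dots> \<le> N y"
      unfolding N_def
      by (rule member_le_sum[of i "{..<n}" "\<lambda>i. y i * y i"]) (use that in auto)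
    finally show ?thesis .
  qed
  obtain y where "\<exists>i<n. y i \<noteq> 0" "\<forall>j<k. (\<Sum>i<n. v j i * y i) = 0"
    using exists_orthogonal_vector[OF assms(1)] by blast
  with N_pos normalize(1) have "S \<noteq> {}" by blast
  moreover have "continuous_on S q"
    unfolding q_def
    by (intro continuous_intros continuous_on_subset[OF cont]) auto
  ultimately obtain x where x: "x \<in> S" "\<And>y. y \<in> S \<Longrightarrow> q y \<le> q x"
    using continuous_attains_sup[OF S] by blast
  have "q y \<le> q x * N y" if y: "\<forall>j<k. (\<Sum>i<n. v j i * y i) = 0" for y
  proof (cases "\<exists>i<n. y i \<noteq> 0")
    case True
    then have "N y > 0" using N_pos by blast
    with x(2)[OF normalize(1)[OF this y]] normalize(2)[OF this y] show ?thesis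
      by (simp add: field_simps)
  next
    case False
    then show ?thesis by (simp add: q_def N_def)
  qed
  then show ?thesis using x(1) by (auto simp: S_def N_def)
qed

lemma linear_le_quadratic_imp_zero:
  fixes c d :: real
  assumes "\<And>s. 2 * s * c \<le> s\<^sup>2 * d"
  shows "c = 0"
proof (rule ccontr)
  assume "c \<noteq> 0"
  then have c: "c\<^sup>2 > 0" by simp
  have "2 * c \<le> d" "- (2 * c) \<le> d"
    using assms[of 1] assms[of "-1"] by simp_all
  then have d: "d \<ge> 0" by linarith
  \<comment> \<open>For this \<open>s\<close> the inequality becomes
    \<open>2 c^2 (d + 1) \<le> c^2 d\<close>, impossible for nonzero \<open>c\<close> and
    \<open>d \<ge> 0\<close>; adding 1 keeps the denominator positive.\<close>
  have "2 * (c / (d + 1)) * c \<le> (c / (d + 1))\<^sup>2 * d"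
    by (rule assms)
  then have "c\<^sup>2 * (2 * (d + 1)) \<le> c\<^sup>2 * d"
    using d by (simp add: power2_eq_square divide_simps) (simp add: algebra_simps)
  with c d show False by simp
qed

text \<open>A maximizer of the quadratic form on the unit vectors orthogonal to the given eigenvectors
  is an eigenvector, since the first variation vanishes in all orthogonal directions, among them
  the residual.\<close>

lemma symmetric_next_eigenvector:
  fixes A v :: "nat \<Rightarrow> nat \<Rightarrow> real"
  assumes sym: "\<And>a b. a < n \<Longrightarrow> b < n \<Longrightarrow> A a b = A b a"
    and eig: "\<And>j a. j < k \<Longrightarrow> a < n \<Longrightarrow> (\<Sum>b<n. A a b * v j b) = \<mu> j * v j a"
    and "k < n"
  shows "\<exists>x l. (\<Sum>i<n. x i * x i) = 1 \<and> (\<forall>j<k. (\<Sum>i<n. v j i * x i) = 0) \<and>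
    (\<forall>a<n. (\<Sum>b<n. A a b * x b) = l * x a)"
proof -
  define q where "q = (\<lambda>x. \<Sum>a<n. \<Sum>b<n. A a b * x a * x b)"
  define N where "N = (\<lambda>x :: nat \<Rightarrow> real. \<Sum>i<n. x i * x i)"
  define orth where "orth = (\<lambda>y. \<forall>j<k. (\<Sum>i<n. v j i * y i) = 0)"
  obtain x where x: "N x = 1" "orth x" and max: "\<And>y. orth y \<Longrightarrow> q y \<le> q x * N y"
    using orthogonal_unit_maximizer[OF \<open>k < n\<close>, of v A] unfolding q_def N_def orth_def by blast
  define l where "l = q x"
  define Ax where "Ax = (\<lambda>a. \<Sum>b<n. A a b * x b)"
  have bilin: "(\<Sum>a<n. \<Sum>b<n. A a b * x a * y b) = (\<Sum>a<n. y a * Ax a)"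
    "(\<Sum>a<n. \<Sum>b<n. A a b * y a * x b) = (\<Sum>a<n. y a * Ax a)" for y
  proof -
    have "(\<Sum>a<n. \<Sum>b<n. A a b * x a * y b) = (\<Sum>b<n. \<Sum>a<n. A a b * x a * y b)"
      by (rule sum.swap)
    also have "\<dots> = (\<Sum>a<n. y a * Ax a)"
      unfolding Ax_def sum_distrib_left by (intro sum.cong) (auto simp: sym)
    finally show "(\<Sum>a<n. \<Sum>b<n. A a b * x a * y b) = (\<Sum>a<n. y a * Ax a)" .
    show "(\<Sum>a<n. \<Sum>b<n. A a b * y a * x b) = (\<Sum>a<n. y a * Ax a)"
      unfolding Ax_def sum_distrib_left by (intro sum.cong) auto
  qed
  have stationary: "(\<Sum>a<n. y a * (Ax a - l * x a)) = 0" if y: "orth y" for y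
  proof (rule linear_le_quadratic_imp_zero)
    fix s
    define T where "T = (\<Sum>a<n. y a * Ax a)"
    define U where "U = (\<Sum>a<n. y a * x a)"
    \<comment> \<open>The perturbed vector is not normalized, which the homogeneous form of
      maximality allows.\<close>
    have "orth (\<lambda>i. x i + s * y i)"
      using x(2) y by (simp add: orth_def distrib_left sum.distrib mult.left_commute
          flip: sum_distrib_left)
    then have "q (\<lambda>i. x i + s * y i) \<le> l * N (\<lambda>i. x i + s * y i)"
      unfolding l_def by (rule max)
    moreover have "q (\<lambda>i. x i + s * y i) = l + 2 * s * T + s\<^sup>2 * q y"
    proof -
      have "q (\<lambda>i. x i + s * y i) = q x + s * (\<Sum>a<n. \<Sum>b<n. A a b * x a * y b) +
          s * (\<Sum>a<n. \<Sum>b<n. A a b * y a * x b) + s\<^sup>2 * q y"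
        unfolding q_def sum_distrib_left sum.distrib[symmetric]
        by (intro sum.cong) (auto simp: algebra_simps power2_eq_square)
      then show ?thesis by (simp add: bilin l_def T_def)
    qed
    moreover have "N (\<lambda>i. x i + s * y i) = 1 + 2 * s * U + s\<^sup>2 * N y"
    proof -
      have "N (\<lambda>i. x i + s * y i) = N x + 2 * s * (\<Sum>a<n. y a * x a) + s\<^sup>2 * N y"
        unfolding N_def sum_distrib_left sum.distrib[symmetric]
        by (intro sum.cong) (auto simp: algebra_simps power2_eq_square)
      then show ?thesis by (simp add: x U_def)
    qed
    ultimately have "l + 2 * s * T + s\<^sup>2 * q y \<le> l * (1 + 2 * s * U + s\<^sup>2 * N y)"
      by simp
    then have "2 * s * (T - l * U) \<le> s\<^sup>2 * (l * N y - q y)"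
      by (simp add: algebra_simps)
    moreover have "(\<Sum>a<n. y a * (Ax a - l * x a)) = T - l * U"
      unfolding T_def U_def sum_distrib_left sum_subtractf[symmetric]
      by (intro sum.cong) (auto simp: algebra_simps)
    ultimately show "2 * s * (\<Sum>a<n. y a * (Ax a - l * x a)) \<le> s\<^sup>2 * (l * N y - q y)"
      by simp
  qed
  \<comment> \<open>Symmetry moves \<open>A\<close> onto \<open>v j\<close>, where it acts as the
    scalar \<open>\<mu> j\<close>; so \<open>Ax\<close> is orthogonal to each \<open>v j\<close> and
    the residual is an admissible direction. Stationarity along it makes its own squared norm
    vanish.\<close>
  have "orth (\<lambda>a. Ax a - l * x a)"
    unfolding orth_def
  proof (intro allI impI)
    fix j assume j: "j < k"
    have "(\<Sum>a<n. v j a * Ax a) = (\<Sum>b<n. \<Sum>a<n. v j a * (A a b * x b))"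
      unfolding Ax_def sum_distrib_left by (rule sum.swap)
    also have "\<dots> = (\<Sum>b<n. (\<Sum>a<n. A b a * v j a) * x b)"
      unfolding sum_distrib_right by (intro sum.cong) (auto simp: sym)
    also have "\<dots> = (\<Sum>b<n. \<mu> j * (v j b * x b))"
      using j by (intro sum.cong) (auto simp: eig)
    also have "\<dots> = 0"
      using x(2) j by (simp add: orth_def flip: sum_distrib_left)
    finally have "(\<Sum>a<n. v j a * Ax a) = 0" .
    moreover have "(\<Sum>a<n. v j a * (l * x a)) = 0"
      using x(2) j by (simp add: orth_def mult.left_commute flip: sum_distrib_left)
    ultimately show "(\<Sum>a<n. v j a * (Ax a - l * x a)) = 0"
      by (simp add: right_diff_distrib sum_subtractf)
  qed
  then have "(\<Sum>a<n. (Ax a - l * x a) * (Ax a - l * x a)) = 0"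
    by (rule stationary)
  then have "\<forall>a\<in>{..<n}. (Ax a - l * x a) * (Ax a - l * x a) = 0"
    by (subst (asm) sum_nonneg_eq_0_iff) auto
  then have "\<forall>a<n. Ax a = l * x a" by simp
  then show ?thesis using x unfolding Ax_def N_def orth_def by blast
qed

text \<open>Formulated as the extension of a given family, so that eigenvectors for a known part of
  the spectrum can be prescribed; one vector is added at a time, from \<open>t\<close> up to
  \<open>n\<close>.\<close>

theorem symmetric_eigenbasis_extension:
  fixes A v :: "nat \<Rightarrow> nat \<Rightarrow> real"
  assumes sym: "\<And>a b. a < n \<Longrightarrow> b < n \<Longrightarrow> A a b = A b a"
    and "t \<le> n"
    and orth: "\<And>i j. i < t \<Longrightarrow> j < t \<Longrightarrow> (\<Sum>a<n. v i a * v j a) = (if i = j then 1 else 0)"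
    and eig: "\<And>j a. j < t \<Longrightarrow> a < n \<Longrightarrow> (\<Sum>b<n. A a b * v j b) = \<mu> j * v j a"
  obtains w \<nu> where "\<And>j. j < t \<Longrightarrow> w j = v j" "\<And>j. j < t \<Longrightarrow> \<nu> j = \<mu> j"
    "\<And>i j. i < n \<Longrightarrow> j < n \<Longrightarrow> (\<Sum>a<n. w i a * w j a) = (if i = j then 1 else 0)"
    "\<And>j a. j < n \<Longrightarrow> a < n \<Longrightarrow> (\<Sum>b<n. A a b * w j b) = \<nu> j * w j a"
proof -
  define good where "good = (\<lambda>m w \<nu>. (\<forall>j<t. w j = v j \<and> \<nu> j = \<mu> j) \<and>
    (\<forall>i<m. \<forall>j<m. (\<Sum>a<n. w i a * w j a) = (if i = j then 1 else 0)) \<and>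
    (\<forall>j<m. \<forall>a<n. (\<Sum>b<n. A a b * w j b) = \<nu> j * w j a))"
  have "\<exists>w \<nu>. good n w \<nu>"
    using \<open>t \<le> n\<close>
  proof (induction n rule: dec_induct[where P = "\<lambda>m. \<exists>w \<nu>. good m w \<nu>"])
    case base
    have "good t v \<mu>" using orth eig by (simp add: good_def)
    then show ?case by blast
  next
    case (step m)
    then obtain w \<nu> where w: "good m w \<nu>" by blast
    then have eig': "(\<Sum>b<n. A a b * w j b) = \<nu> j * w j a" if "j < m" "a < n" for j a
      using that by (simp add: good_def)
    have "\<exists>x l. (\<Sum>i<n. x i * x i) = 1 \<and> (\<forall>j<m. (\<Sum>i<n. w j i * x i) = 0) \<and>
        (\<forall>a<n. (\<Sum>b<n. A a b * x b) = l * x a)"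
      using step.hyps(2) by (intro symmetric_next_eigenvector[where \<mu> = \<nu>] sym eig')
    then obtain x l where x: "(\<Sum>i<n. x i * x i) = 1" "\<forall>j<m. (\<Sum>i<n. w j i * x i) = 0"
        "\<forall>a<n. (\<Sum>b<n. A a b * x b) = l * x a"
      by blast
    have "(\<Sum>a<n. (w(m := x)) i a * (w(m := x)) j a) = (if i = j then 1 else 0)"
      if "i < Suc m" "j < Suc m" for i j
      using that x(1,2) w by (cases "i = m"; cases "j = m") (simp_all add: good_def mult.commute)
    moreover have "(\<Sum>b<n. A a b * (w(m := x)) j b) = (\<nu>(m := l)) j * (w(m := x)) j a"
      if "j < Suc m" "a < n" for j a
      using that x(3) eig' by (cases "j = m") simp_all
    ultimately have "good (Suc m) (w(m := x)) (\<nu>(m := l))"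
      using w step.hyps unfolding good_def by simp
    then show ?case by blast
  qed
  then show thesis using that unfolding good_def by blast
qed

section \<open>Balance and potentials\<close>

text \<open>\<open>balanced\<close> only speaks of cycles of length at least 3. Strong induction on
  the length covers the rest: a closed walk that repeats no vertex except its endpoint is such a
  cycle, empty, or an edge walked forth and back, and any other one splits off a shorter closed
  walk.\<close>

lemma gain_closed_walk:
  fixes \<phi> :: "'v \<times> 'v \<Rightarrow> 'a :: gain_scalar dual"
  assumes "gain_graph G \<phi>" and bal: "balanced G \<phi>"
    and "pre_digraph.awalk (with_proj G) u p u"
  shows "prod_list (map \<phi> p) = 1"
proof -
  interpret pair_graph G using assms(1) by (simp add: gain_graph_def)
  from assms(3) show ?thesis
  proof (induction "length p" arbitrary: u p rule: less_induct)
    case less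
    show ?case
    proof (cases p)
      case (Cons e es)
      have e: "e \<in> parcs G" "fst e = u" and es: "awalk (snd e) es u"
        using less.prems Cons by (auto simp: awalk_Cons_iff)
      show ?thesis
      proof (cases "distinct (pawalk_verts (snd e) es)")
        case True
        then have "cycle p"
          using less.prems Cons unfolding cycle_def by auto
        then have long: "3 \<le> length p \<Longrightarrow> ?thesis"
          using bal by (auto simp: balanced_def)
        show ?thesis
        proof (cases es)
          case Nil
          with es have "snd e = u" by (simp add: awalk_Nil_iff)
          with e no_loops[of e] show ?thesis by simp
        next
          case es': (Cons f fs)
          show ?thesis
          proof (cases fs)
            case Nil
            with es es' have "f = (snd e, u)"
              by (auto simp: awalk_Cons_iff awalk_Nil_iff prod_eq_iff)
            moreover have "e = (u, snd e)"
              using e(2) by auto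
            moreover have "\<phi> (u, snd e) * \<phi> (snd e, u) = 1"
              using assms(1) e calculation(2) unfolding gain_graph_def by fastforce
            ultimately show ?thesis using Cons es' Nil by simp
          next
            case (Cons g gs)
            with \<open>p = e # es\<close> es' show ?thesis by (intro long) simp
          qed
        qed
      next
        case False
        \<comment> \<open>A repeated vertex \<open>w\<close> cuts out a nonempty closed walk
          \<open>r\<close>. Both \<open>r\<close> and the walk with \<open>r\<close> removed are
          shorter than \<open>p\<close>, and \<open>r\<close> contributes only the factor 1.\<close>
        then obtain q r s w where dec: "es = q @ r @ s" "0 < length r"
            "awalk (snd e) q w" "awalk w r w" "awalk w s u"
          using awalk_not_distinct_decomp[OF es] by blast
        have "prod_list (map \<phi> r) = 1"
          using dec Cons by (intro less.hyps[OF _ dec(4)]) simp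
        moreover have "awalk u (e # q @ s) u"
          using dec e less.prems Cons by (auto simp: awalk_Cons_iff intro: awalk_appendI)
        then have "prod_list (map \<phi> (e # q @ s)) = 1"
          using dec Cons by (intro less.hyps) auto
        ultimately show ?thesis using Cons dec(1) by (simp add: mult.assoc)
      qed
    qed simp
  qed
qed

lemma conjugate_unit_prod_list:
  fixes as :: "'a :: gain_scalar dual list"
  assumes "\<And>a. a \<in> set as \<Longrightarrow> conjugate a * a = 1"
  shows "conjugate (prod_list as) * prod_list as = 1"
  using assms
proof (induction as)
  case (Cons a as)
  have "conjugate (prod_list (a # as)) * prod_list (a # as) =
      conjugate (prod_list as) * (conjugate a * a) * prod_list as"
    by (simp add: conjugate_dual_arith mult.assoc)
  with Cons show ?case by simp
qed (simp add: conjugate_dual_arith)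

text \<open>The potential of a vertex is the gain of a walk from it to a root of its component.\<close>

lemma balanced_potential:
  fixes \<phi> :: "'v \<times> 'v \<Rightarrow> 'a :: gain_scalar dual"
  assumes "unit_gain_graph G \<phi>" "balanced G \<phi>"
  obtains \<theta> where "\<And>v. v \<in> pverts G \<Longrightarrow> conjugate (\<theta> v) * \<theta> v = 1"
    "\<And>u v. (u, v) \<in> parcs G \<Longrightarrow> conjugate (\<theta> u) * \<phi> (u, v) * \<theta> v = 1"
proof -
  have gg: "gain_graph G \<phi>" using assms(1) by (simp add: unit_gain_graph_def)
  interpret pair_graph G using gg by (simp add: gain_graph_def)
  define root where "root = (\<lambda>v. SOME w. v \<rightarrow>\<^sup>*\<^bsub>with_proj G\<^esub> w)"
  define walk where "walk = (\<lambda>v. SOME p. awalk v p (root v))"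
  define \<theta> where "\<theta> = (\<lambda>v. prod_list (map \<phi> (walk v)))"
  have walk: "awalk v (walk v) (root v)" if "v \<in> pverts G" for v
  proof -
    have "v \<rightarrow>\<^sup>*\<^bsub>with_proj G\<^esub> root v"
      unfolding root_def by (rule someI[of _ v]) (use that in auto)
    then show ?thesis
      unfolding walk_def reachable_awalk by (rule someI_ex)
  qed
  have unit: "conjugate (\<theta> v) * \<theta> v = 1" if "v \<in> pverts G" for v
    unfolding \<theta>_def
  proof (rule conjugate_unit_prod_list)
    fix a assume "a \<in> set (map \<phi> (walk v))"
    then obtain e where "a = \<phi> e" "e \<in> set (walk v)"
      by auto
    moreover from this have "e \<in> parcs G"
      using walk[OF \<open>v \<in> pverts G\<close>] by (auto simp: awalk_def)
    ultimately show "conjugate a * a = 1"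
      using assms(1) by (simp add: unit_gain_graph_def flip: magnitude_eq_one_iff)
  qed
  moreover have "conjugate (\<theta> u) * \<phi> (u, v) * \<theta> v = 1" if uv: "(u, v) \<in> parcs G" for u v
  proof -
    have verts: "u \<in> pverts G" "v \<in> pverts G" using uv by (auto dest: wellformed')
    have "(v, u) \<in> parcs G" using uv by (rule arcs_symmetric)
    with uv have "u \<rightarrow>\<^sup>*\<^bsub>with_proj G\<^esub> w \<longleftrightarrow> v \<rightarrow>\<^sup>*\<^bsub>with_proj G\<^esub> w" for w
      by (metis adj_reachable_trans with_proj_simps(3))
    \<comment> \<open>Adjacent vertices reach the same vertices, so \<open>SOME\<close> is applied
      to the same predicate and yields the same root.\<close>
    then have root: "root v = root u" unfolding root_def by presburger
    \<comment> \<open>The gain \<open>g\<close> of the way back is determined indirectly: going out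
      and back is a closed walk, so \<open>g\<close> inverts \<open>\<theta> u\<close>. The same way
      back closes the walk through \<open>v\<close>, which makes
      \<open>\<phi> (u, v) * \<theta> v\<close> equal to \<open>\<theta> u\<close>.\<close>
    define g where "g = prod_list (map \<phi> (rev_path (walk u)))"
    have ret: "awalk (root u) (rev_path (walk u)) u"
      using walk[OF verts(1)] by simp
    have "awalk u (walk u @ rev_path (walk u)) u"
      using walk[OF verts(1)] ret by (rule awalk_appendI)
    from gain_closed_walk[OF gg assms(2) this] have "\<theta> u * g = 1"
      by (simp add: \<theta>_def g_def)
    then have "g * \<theta> u = 1" by (rule dual_left_inverse_right_inverse)
    moreover have "awalk u ((u, v) # walk v) (root u)"
      using walk[OF verts(2)] uv verts root by (simp add: awalk_Cons_iff)
    then have "awalk u (((u, v) # walk v) @ rev_path (walk u)) u"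
      using ret by (rule awalk_appendI)
    from gain_closed_walk[OF gg assms(2) this] have "\<phi> (u, v) * \<theta> v * g = 1"
      by (simp add: \<theta>_def g_def mult.assoc)
    ultimately have "\<phi> (u, v) * \<theta> v = \<theta> u"
      by (metis mult.assoc mult_1_left mult_1_right)
    with unit[OF verts(1)] show ?thesis by (simp add: mult.assoc)
  qed
  ultimately show thesis by (rule that)
qed

lemma potential_imp_balanced:
  fixes \<phi> :: "'v \<times> 'v \<Rightarrow> 'a :: gain_scalar dual"
  assumes "pair_graph G"
    and unit: "\<And>v. v \<in> pverts G \<Longrightarrow> conjugate (\<theta> v) * \<theta> v = 1"
    and pot: "\<And>u v. (u, v) \<in> parcs G \<Longrightarrow> conjugate (\<theta> u) * \<phi> (u, v) * \<theta> v = 1"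
  shows "balanced G \<phi>"
proof -
  interpret pair_graph G by fact
  have unit': "\<theta> v * conjugate (\<theta> v) = 1" if "v \<in> pverts G" for v
    using unit[OF that] by (rule dual_left_inverse_right_inverse)
  have edge: "\<phi> (u, v) * \<theta> v = \<theta> u" if "(u, v) \<in> parcs G" for u v
  proof -
    have "\<theta> u * (conjugate (\<theta> u) * \<phi> (u, v) * \<theta> v) = \<theta> u"
      using pot[OF that] by simp
    then show ?thesis
      using unit'[of u] that by (simp add: wellformed' flip: mult.assoc)
  qed
  have walk: "prod_list (map \<phi> p) * \<theta> v = \<theta> u" if "awalk u p v" for u p v
    using that
  proof (induction p arbitrary: u)
    case (Cons e p)
    then show ?case
      using edge[of "fst e" "snd e"] by (auto simp: awalk_Cons_iff mult.assoc)
  qed (simp add: awalk_Nil_iff)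
  show ?thesis
    unfolding balanced_def
  proof (intro allI impI)
    fix p assume "cycle p \<and> 3 \<le> length p"
    then obtain u where u: "awalk u p u" by (auto simp: cycle_def)
    then have "u \<in> pverts G" by auto
    have "prod_list (map \<phi> p) * (\<theta> u * conjugate (\<theta> u)) = \<theta> u * conjugate (\<theta> u)"
      using walk[OF u] by (simp flip: mult.assoc)
    with unit'[OF \<open>u \<in> pverts G\<close>] show "prod_list (map \<phi> p) = 1" by simp
  qed
qed

section \<open>The Laplacian matrix\<close>

locale interval_graph = pair_graph G for G :: "nat pair_pre_digraph" +
  fixes n :: nat
  assumes verts_eq: "pverts G = {0..<n}"
begin

lemma arc_less: "(u, v) \<in> parcs G \<Longrightarrow> u < n" "(u, v) \<in> parcs G \<Longrightarrow> v < n"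
  using wellformed' verts_eq by auto

lemma gain_laplacian_carrier [simp]: "gain_laplacian G \<phi> \<in> carrier_mat n n"
  unfolding gain_laplacian_def degree_matrix_def gain_adjacency_def verts_eq
  by (intro minus_carrier_mat) simp

lemma dim_gain_laplacian [simp]:
  "dim_row (gain_laplacian G \<phi>) = n" "dim_col (gain_laplacian G \<phi>) = n"
  using gain_laplacian_carrier by (metis carrier_matD)+

lemma graph_laplacian_eq: "graph_laplacian G = gain_laplacian G (\<lambda>_. 1)"
  by (simp add: graph_laplacian_def gain_laplacian_def gain_adjacency_def)

lemma gain_laplacian_index:
  assumes "i < n" "j < n"
  shows "gain_laplacian G \<phi> $$ (i, j) =
    (if i = j then of_nat (out_degree (with_proj G) i) else 0) - (if (i, j) \<in> parcs G then \<phi> (i, j) else 0)"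
  using assms
  by (simp add: gain_laplacian_def degree_matrix_def gain_adjacency_def verts_eq mat_diag_def)

lemma out_degree_sum:
  "(of_nat (out_degree (with_proj G) i) :: 'a :: ring_1) = (\<Sum>j<n. if (i, j) \<in> parcs G then 1 else 0)"
proof -
  have "out_arcs (with_proj G) i = Pair i ` {j \<in> {..<n}. (i, j) \<in> parcs G}"
    using arc_less by (auto simp: out_arcs_def)
  then have "out_degree (with_proj G) i = card {j \<in> {..<n}. (i, j) \<in> parcs G}"
    by (simp add: out_degree_def card_image inj_on_def)
  then show ?thesis by (simp add: sum.If_cases Int_def)
qed

text \<open>The degree counts the arcs leaving \<open>i\<close>; distributed over them, it turns the
  operator into a sum of differences along arcs. Stated for any ring with 1, it serves both the real
  matrix and the dual scalars.\<close>

lemma gain_laplacian_sum: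
  fixes \<phi> :: "nat \<times> nat \<Rightarrow> 'a :: ring_1"
  assumes "i < n"
  shows "(\<Sum>j<n. gain_laplacian G \<phi> $$ (i, j) * f j) =
    (\<Sum>j<n. if (i, j) \<in> parcs G then f i - \<phi> (i, j) * f j else 0)"
proof -
  have "(\<Sum>j<n. gain_laplacian G \<phi> $$ (i, j) * f j) =
      (\<Sum>j<n. (if i = j then of_nat (out_degree (with_proj G) i) * f j else 0) -
        (if (i, j) \<in> parcs G then \<phi> (i, j) * f j else 0))"
    using assms by (intro sum.cong) (auto simp: gain_laplacian_index algebra_simps)
  also have "\<dots> = (\<Sum>j<n. if (i, j) \<in> parcs G then 1 else 0) * f i -
      (\<Sum>j<n. if (i, j) \<in> parcs G then \<phi> (i, j) * f j else 0)"
    using assms by (simp add: sum_subtractf out_degree_sum)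
  also have "\<dots> = (\<Sum>j<n. if (i, j) \<in> parcs G then f i - \<phi> (i, j) * f j else 0)"
    unfolding sum_distrib_right sum_subtractf[symmetric] by (intro sum.cong) auto
  finally show ?thesis .
qed

lemma gain_laplacian_mult_vec:
  fixes \<phi> :: "nat \<times> nat \<Rightarrow> 'a :: ring_1"
  assumes "i < n" "x \<in> carrier_vec n"
  shows "(gain_laplacian G \<phi> *\<^sub>v x) $ i =
    (\<Sum>j<n. if (i, j) \<in> parcs G then x $ i - \<phi> (i, j) * x $ j else 0)"
proof -
  have "(gain_laplacian G \<phi> *\<^sub>v x) $ i = (\<Sum>j<n. gain_laplacian G \<phi> $$ (i, j) * x $ j)"
    using assms by (auto simp: scalar_prod_def lessThan_atLeast0 intro!: sum.cong)
  also have "\<dots> = (\<Sum>j<n. if (i, j) \<in> parcs G then x $ i - \<phi> (i, j) * x $ j else 0)"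
    using assms by (intro gain_laplacian_sum[of i \<phi> "\<lambda>j. x $ j"])
  finally show ?thesis .
qed

section \<open>Sums over arcs and positivity\<close>

lemma sum_arcs_swap:
  fixes F :: "nat \<Rightarrow> nat \<Rightarrow> 'a :: comm_monoid_add"
  shows "(\<Sum>u<n. \<Sum>v<n. if (u, v) \<in> parcs G then F v u else 0) =
    (\<Sum>u<n. \<Sum>v<n. if (u, v) \<in> parcs G then F u v else 0)"
  by (subst sum.swap) (intro sum.cong refl if_cong, auto intro: arcs_symmetric)

text \<open>Twice the inner product of \<open>f\<close> with its Laplacian is the sum of
  \<open>(f u - f v)^2\<close> over all arcs, and a vanishing sum of squares has only zero
  terms.\<close>

lemma real_laplacian_kernel:
  fixes f :: "nat \<Rightarrow> real"
  assumes ker: "\<And>a. a < n \<Longrightarrow> (\<Sum>b<n. graph_laplacian G $$ (a, b) * f b) = 0"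
    and "(u, v) \<in> parcs G"
  shows "f u = f v"
proof -
  let ?E = "\<lambda>g. \<Sum>u<n. \<Sum>v<n. if (u, v) \<in> parcs G then g u v else (0 :: real)"
  have "?E (\<lambda>u v. f u * (f u - f v)) = (\<Sum>u<n. f u * (\<Sum>v<n. graph_laplacian G $$ (u, v) * f v))"
    unfolding graph_laplacian_eq
    by (intro sum.cong) (auto simp: gain_laplacian_sum sum_distrib_left intro!: sum.cong)
  also have "\<dots> = 0" using ker by simp
  finally have zero: "?E (\<lambda>u v. f u * (f u - f v)) = 0" .
  have "?E (\<lambda>u v. (f u - f v)\<^sup>2) =
      ?E (\<lambda>u v. f u * (f u - f v)) + ?E (\<lambda>u v. f v * (f v - f u))"
    unfolding sum.distrib[symmetric]
    by (intro sum.cong) (auto simp: power2_eq_square algebra_simps)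
  also have "\<dots> = 0"
    using zero sum_arcs_swap[of "\<lambda>u v. f u * (f u - f v)"] by simp
  finally have "?E (\<lambda>u v. (f u - f v)\<^sup>2) = 0" .
  then have "\<forall>u\<in>{..<n}. (\<Sum>v<n. if (u, v) \<in> parcs G then (f u - f v)\<^sup>2 else 0) = 0"
    by (subst (asm) sum_nonneg_eq_0_iff) (auto intro: sum_nonneg)
  then have "(\<Sum>v<n. if (u, v) \<in> parcs G then (f u - f v)\<^sup>2 else 0) = 0"
    using arc_less[OF assms(2)] by blast
  then have "\<forall>v\<in>{..<n}. (if (u, v) \<in> parcs G then (f u - f v)\<^sup>2 else 0) = 0"
    by (subst (asm) sum_nonneg_eq_0_iff) auto
  then have "(if (u, v) \<in> parcs G then (f u - f v)\<^sup>2 else 0) = 0"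
    using arc_less[OF assms(2)] by blast
  with assms(2) show ?thesis by simp
qed

text \<open>A sum of squared moduli, so the eigenvalues are nonnegative dual numbers.\<close>

lemma dirichlet_form:
  fixes \<phi> :: "nat \<times> nat \<Rightarrow> 'a :: gain_scalar dual"
  assumes "unit_gain_graph G \<phi>" and x: "x \<in> carrier_vec n"
  shows "2 * (\<Sum>u<n. conjugate (x $ u) * (gain_laplacian G \<phi> *\<^sub>v x) $ u) =
    of_dual (\<Sum>u<n. \<Sum>v<n. if (u, v) \<in> parcs G then dual_normsq (x $ u - \<phi> (u, v) * x $ v) else 0)"
proof -
  let ?E = "\<lambda>g. \<Sum>u<n. \<Sum>v<n. if (u, v) \<in> parcs G then g u v else (0 :: 'a dual)"
  define F where "F = (\<lambda>u v. conjugate (x $ u) * (x $ u - \<phi> (u, v) * x $ v))"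
  have form: "?E F = (\<Sum>u<n. conjugate (x $ u) * (gain_laplacian G \<phi> *\<^sub>v x) $ u)"
    unfolding F_def
    by (intro sum.cong)
      (auto simp: gain_laplacian_mult_vec[OF _ x] sum_distrib_left simp del: index_mult_mat_vec
        intro!: sum.cong)
  \<comment> \<open>Of the four terms of the squared modulus each orientation of the edge supplies
    two; summing over both orientations yields the factor 2.\<close>
  have F: "of_dual (dual_normsq (x $ u - \<phi> (u, v) * x $ v)) = F u v + F v u"
    if uv: "(u, v) \<in> parcs G" for u v
  proof -
    have unit: "conjugate (\<phi> (u, v)) * \<phi> (u, v) = 1" "\<phi> (u, v) * \<phi> (v, u) = 1"
      using assms(1) uv
      by (auto simp: unit_gain_graph_def gain_graph_def simp flip: magnitude_eq_one_iff)
    have "conjugate (\<phi> (u, v)) = conjugate (\<phi> (u, v)) * (\<phi> (u, v) * \<phi> (v, u))"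
      by (simp add: unit)
    also have "\<dots> = \<phi> (v, u)"
      by (simp only: mult.assoc[symmetric] unit(1) mult_1_left)
    finally have inv: "conjugate (\<phi> (u, v)) = \<phi> (v, u)" .
    have "\<phi> (v, u) * \<phi> (u, v) = 1"
      using assms(1) uv by (auto simp: unit_gain_graph_def gain_graph_def)
    then have inv': "\<phi> (v, u) * (\<phi> (u, v) * a) = a" for a
      by (simp flip: mult.assoc)
    show ?thesis
      by (simp add: of_dual_normsq F_def conjugate_dual_arith inv inv' algebra_simps)
  qed
  have "of_dual (\<Sum>u<n. \<Sum>v<n. if (u, v) \<in> parcs G then dual_normsq (x $ u - \<phi> (u, v) * x $ v) else 0) =
      ?E F + ?E (\<lambda>u v. F v u)"
    unfolding of_dual_sum sum.distrib[symmetric]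
    by (intro sum.cong) (auto simp: F of_dual_arith)
  also have "\<dots> = 2 * ?E F"
    using sum_arcs_swap[of F] by (simp only: mult_2)
  finally show ?thesis using form by simp
qed

text \<open>Pairing the eigenvector equation with \<open>x\<close> from the left expresses the
  quadratic form as the squared norm of \<open>x\<close> times \<open>\<mu>\<close>. That norm is a
  dual number with positive standard part, hence invertible, so \<open>\<mu>\<close> is a quotient
  of dual numbers with nonnegative numerator.\<close>

lemma right_eigenvalue_nonneg:
  fixes \<phi> :: "nat \<times> nat \<Rightarrow> 'a :: gain_scalar dual"
  assumes "unit_gain_graph G \<phi>" "right_eigenvalue (gain_laplacian G \<phi>) \<mu>"
  shows "\<exists>m. \<mu> = of_dual m \<and> 0 \<le> m"
proof -
  obtain x where x: "x \<in> carrier_vec n" and nz: "\<exists>j<n. std_part (x $ j) \<noteq> 0"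
    and eig: "gain_laplacian G \<phi> *\<^sub>v x = map_vec (\<lambda>a. a * \<mu>) x"
    using assms(2) by (auto simp: right_eigenvalue_def right_eigenvector_def)
  define s where "s = (\<Sum>u<n. dual_normsq (x $ u))"
  \<comment> \<open>Doubled to match the factor 2 in \<open>dirichlet_form\<close>.\<close>
  define p where "p = s + s"
  define q where "q = (\<Sum>u<n. \<Sum>v<n.
    if (u, v) \<in> parcs G then dual_normsq (x $ u - \<phi> (u, v) * x $ v) else 0)"
  have "0 \<le> q"
    unfolding q_def by (intro dual_sum_nonneg) (simp add: dual_normsq_nonneg)
  obtain j where j: "j < n" "std_part (x $ j) \<noteq> 0" using nz by blast
  have "0 < (norm (std_part (x $ j)))\<^sup>2" using j by simp
  also have "\<dots> \<le> (\<Sum>u<n. (norm (std_part (x $ u)))\<^sup>2)"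
    using j(1) by (intro member_le_sum[of j "{..<n}" "\<lambda>u. (norm (std_part (x $ u)))\<^sup>2"]) auto
  finally have p: "std_part p > 0"
    by (simp add: p_def s_def std_part_sum dual_normsq_def)
  have "(\<Sum>u<n. conjugate (x $ u) * map_vec (\<lambda>a. a * \<mu>) x $ u) = of_dual s * \<mu>"
    unfolding s_def of_dual_sum sum_distrib_right
    using x by (intro sum.cong) (simp_all add: of_dual_normsq mult.assoc)
  then have "of_dual q = 2 * (of_dual s * \<mu>)"
    unfolding q_def dirichlet_form[OF assms(1) x, symmetric] eig by (rule arg_cong)
  also have "\<dots> = of_dual p * \<mu>"
    by (simp only: p_def mult_2 of_dual_arith distrib_right)
  finally have pq: "of_dual p * \<mu> = of_dual q" ..
  have inv: "inverse p * p = 1" using p by (intro dual_inverse) simp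
  have "\<mu> = of_dual (inverse p * p) * \<mu>" by (simp add: inv of_dual_arith)
  also have "\<dots> = of_dual (inverse p * q)"
    by (simp add: of_dual_arith(4) mult.assoc pq)
  finally have \<mu>: "\<mu> = of_dual (inverse p * q)" .
  have "p * (inverse p * q) = q"
    using dual_inverse(1)[of p] p by (simp flip: mult.assoc)
  with \<open>0 \<le> q\<close> have "0 \<le> inverse p * q"
    using dual_nonneg_cancel[OF p, of "inverse p * q"] by simp
  with \<mu> show ?thesis by blast
qed

text \<open>Off the diagonal the product carries the negated switched gains on arcs and 0 elsewhere.
  On the diagonal the degrees are central, so the unit condition leaves them unchanged.\<close>

lemma switching_iff_potential:
  fixes \<phi> :: "nat \<times> nat \<Rightarrow> 'a :: gain_scalar dual"
  assumes unit: "\<And>j. j < n \<Longrightarrow> conjugate (y j) * y j = 1"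
  shows "conj_transpose (mat_diag n y) * gain_laplacian G \<phi> * mat_diag n y = graph_laplacian G \<longleftrightarrow>
    (\<forall>u v. (u, v) \<in> parcs G \<longrightarrow> conjugate (y u) * \<phi> (u, v) * y v = 1)"
    (is "?M = _ \<longleftrightarrow> ?pot")
proof -
  have ct: "conj_transpose (mat_diag n y) = mat_diag n (\<lambda>j. conjugate (y j))"
    by (auto simp: conj_transpose_def mat_diag_def conjugate_dual_arith intro!: eq_matI)
  have M: "?M = mat n n (\<lambda>(i, j). conjugate (y i) * gain_laplacian G \<phi> $$ (i, j) * y j)"
    unfolding ct
    by (subst mat_diag_mult_left[of _ n n], simp, subst mat_diag_mult_right[of _ n n], auto)
  have entry: "?M $$ (i, j) = (if i = j then of_nat (out_degree (with_proj G) i) else 0) -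
      (if (i, j) \<in> parcs G then conjugate (y i) * \<phi> (i, j) * y j else 0)"
    if ij: "i < n" "j < n" for i j
  proof (cases "i = j")
    case True
    then have "(i, j) \<notin> parcs G" using no_loops'[of i j] by blast
    have "conjugate (y i) * of_nat k * y i = of_nat k * (conjugate (y i) * y i)" for k
      by (subst mult_of_nat_commute[symmetric]) (rule mult.assoc)
    then have "conjugate (y i) * of_nat k * y i = of_nat k" for k
      using unit[OF ij(1)] by simp
    with True \<open>(i, j) \<notin> parcs G\<close> ij show ?thesis by (simp add: M gain_laplacian_index)
  qed (use ij in \<open>simp add: M gain_laplacian_index\<close>)
  show ?thesis
  proof
    assume eq: "?M = graph_laplacian G"
    show ?pot
    proof (intro allI impI)
      fix u v assume uv: "(u, v) \<in> parcs G"
      have "?M $$ (u, v) = gain_laplacian G (\<lambda>_. 1) $$ (u, v)"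
        by (simp only: eq graph_laplacian_eq)
      then show "conjugate (y u) * \<phi> (u, v) * y v = 1"
        using uv arc_less[OF uv] by (simp add: entry gain_laplacian_index split: if_splits)
    qed
  next
    assume ?pot
    show "?M = graph_laplacian G"
    proof (rule eq_matI)
      fix i j assume "i < dim_row (graph_laplacian G :: 'a dual mat)"
        "j < dim_col (graph_laplacian G :: 'a dual mat)"
      then have ij: "i < n" "j < n" by (simp_all add: graph_laplacian_eq)
      show "?M $$ (i, j) = graph_laplacian G $$ (i, j)"
        unfolding entry[OF ij] graph_laplacian_eq gain_laplacian_index[OF ij]
        using \<open>?pot\<close> by simp
    qed (simp_all add: M graph_laplacian_eq)
  qed
qed

end

section \<open>Components and the spectrum of the Laplacian\<close>

lemma card_block [simp]: "card (block ns i) = ns i"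
  by (simp add: block_def flip: lessThan_Suc_atMost)

lemma finite_block [simp]: "finite (block ns i)"
  by (simp add: block_def)

text \<open>Arcs occur in both orientations, so the strongly connected components are the connected
  components.\<close>

locale block_graph = interval_graph G n for G :: "nat pair_pre_digraph" and n :: nat +
  fixes t :: nat and ns :: "nat \<Rightarrow> nat"
  assumes pos: "1 \<le> n"
    and card_components: "card sccs_verts = t"
    and components: "sccs_verts = block ns ` {1..t}"
begin

section \<open>Vertex blocks as components\<close>

lemma block_component: "i \<in> {1..t} \<Longrightarrow> block ns i \<in> sccs_verts"
  by (simp add: components)

lemma block_subset: "i \<in> {1..t} \<Longrightarrow> block ns i \<subseteq> {0..<n}"
  using sccs_verts_subsets[OF block_component, of i] by (simp add: verts_eq)

lemma block_nonempty: "i \<in> {1..t} \<Longrightarrow> block ns i \<noteq> {}"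
  using block_component[of i] by (simp add: in_sccs_verts_conv_reachable)

lemma block_size_pos: "i \<in> {1..t} \<Longrightarrow> 0 < ns i"
  using block_nonempty[of i] card_gt_0_iff[of "block ns i"] by simp

text \<open>Distinct components are disjoint, and \<open>block ns\<close> is injective on the
  indices because its image has \<open>t\<close> elements.\<close>

lemma block_disjoint:
  assumes "i \<in> {1..t}" "k \<in> {1..t}" "j \<in> block ns i" "j \<in> block ns k"
  shows "i = k"
proof -
  have "inj_on (block ns) {1..t}"
    using card_components unfolding components by (intro eq_card_imp_inj_on) auto
  moreover have "block ns i = block ns k"
    using assms sccs_verts_disjoint[OF block_component block_component, of i k] by blast
  ultimately show ?thesis using assms(1,2) by (auto dest: inj_onD)
qed

lemma block_exists:
  assumes "j < n"
  obtains i where "i \<in> {1..t}" "j \<in> block ns i"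
proof -
  have "scc_of j \<in> sccs_verts" "j \<in> scc_of j"
    using assms verts_eq by (auto intro: scc_of_in_sccs_verts in_scc_of_self)
  then show thesis using that unfolding components by auto
qed

lemma components_pos: "1 \<le> t"
proof -
  obtain i where "i \<in> {1..t}" using block_exists[of 0] pos by auto
  then show ?thesis by simp
qed

lemma arc_block_iff:
  assumes "(u, v) \<in> parcs G" "i \<in> {1..t}"
  shows "u \<in> block ns i \<longleftrightarrow> v \<in> block ns i"
proof -
  have "u \<rightarrow>\<^sup>*\<^bsub>with_proj G\<^esub> v" "v \<rightarrow>\<^sup>*\<^bsub>with_proj G\<^esub> u"
    using assms(1) arcs_symmetric[OF assms(1)] by auto
  then show ?thesis
    using block_component[OF assms(2)] unfolding in_sccs_verts_conv_reachable by blast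
qed

lemma block_constant:
  assumes "i \<in> {1..t}" "u \<in> block ns i" "v \<in> block ns i"
    and edge: "\<And>u v. (u, v) \<in> parcs G \<Longrightarrow> f u = f v"
  shows "f u = f v"
proof -
  have "u \<rightarrow>\<^sup>*\<^bsub>with_proj G\<^esub> v"
    using block_component[OF assms(1)] assms(2,3) unfolding in_sccs_verts_conv_reachable by blast
  then show ?thesis
    by (induction rule: reachable_induct) (auto dest: edge)
qed

lemma components_le: "t \<le> n"
proof -
  have "t \<le> card (pverts G)"
    unfolding card_components[symmetric] sccs_verts_conv_scc_of
    using verts_eq by (intro card_image_le) simp
  then show ?thesis by (simp add: verts_eq)
qed

text \<open>This is \<open>1 / sqrt (ns i)\<close>, the constant value that gives a vector supported
  on a block of \<open>ns i\<close> vertices norm 1.\<close>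

definition coefficient :: "nat \<Rightarrow> real" where
  "coefficient i = sqrt (real (ns i)) / real (ns i)"

lemma coefficient_pos: "i \<in> {1..t} \<Longrightarrow> 0 < coefficient i"
  using block_size_pos by (simp add: coefficient_def)

definition indicator_vector :: "nat \<Rightarrow> nat \<Rightarrow> real" where
  "indicator_vector i j = (if j \<in> block ns i then coefficient i else 0)"

lemma sum_block:
  assumes "i \<in> {1..t}"
  shows "(\<Sum>a<n. if a \<in> block ns i then f a else 0) = (\<Sum>a\<in>block ns i. f a)"
proof -
  have "{..<n} \<inter> block ns i = block ns i" using block_subset[OF assms] by auto
  then show ?thesis by (simp add: sum.inter_restrict[symmetric])
qed

lemma indicator_vector_orthonormal:
  assumes "i \<in> {1..t}" "k \<in> {1..t}"
  shows "(\<Sum>a<n. indicator_vector i a * indicator_vector k a) = (if i = k then 1 else 0)"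
proof (cases "i = k")
  case True
  have "(\<Sum>a<n. indicator_vector i a * indicator_vector i a) =
      (\<Sum>a<n. if a \<in> block ns i then coefficient i * coefficient i else 0)"
    by (intro sum.cong) (auto simp: indicator_vector_def)
  also have "\<dots> = real (ns i) * (coefficient i * coefficient i)"
    using assms(1) by (simp only: sum_block) simp
  also have "\<dots> = 1"
    using block_size_pos[OF assms(1)] by (simp add: coefficient_def)
  finally show ?thesis using True by simp
next
  case False
  then have zero: "indicator_vector i a * indicator_vector k a = 0" for a
    using block_disjoint[OF assms] by (auto simp: indicator_vector_def)
  from False show ?thesis by (simp only: zero sum.neutral_const if_False)
qed

lemma indicator_vector_kernel:
  assumes "i \<in> {1..t}" "a < n"
  shows "(\<Sum>b<n. graph_laplacian G $$ (a, b) * indicator_vector i b) = 0"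
  unfolding graph_laplacian_eq gain_laplacian_sum[OF assms(2)]
  using arc_block_iff[OF _ assms(1)] by (intro sum.neutral) (auto simp: indicator_vector_def)

text \<open>A further eigenvector for 0 would be constant on each block and orthogonal to the
  block's indicator, hence 0, against its norm 1.\<close>

lemma real_eigenbasis:
  obtains w :: "nat \<Rightarrow> nat \<Rightarrow> real" and \<nu> where
    "\<And>i j. i < n \<Longrightarrow> j < n \<Longrightarrow> (\<Sum>a<n. w i a * w j a) = (if i = j then 1 else 0)"
    "\<And>j a. j < n \<Longrightarrow> a < n \<Longrightarrow> (\<Sum>b<n. graph_laplacian G $$ (a, b) * w j b) = \<nu> j * w j a"
    "\<And>j. j < n \<Longrightarrow> \<nu> j = 0 \<longleftrightarrow> j < t"
proof -
  have sym: "(graph_laplacian G :: real mat) $$ (a, b) = graph_laplacian G $$ (b, a)"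
    if "a < n" "b < n" for a b
    using that arcs_symmetric by (auto simp: graph_laplacian_eq gain_laplacian_index)
  obtain w :: "nat \<Rightarrow> nat \<Rightarrow> real" and \<nu> where
    w: "\<And>j. j < t \<Longrightarrow> w j = indicator_vector (Suc j)" "\<And>j. j < t \<Longrightarrow> \<nu> j = 0"
    and orth: "\<And>i j. i < n \<Longrightarrow> j < n \<Longrightarrow> (\<Sum>a<n. w i a * w j a) = (if i = j then 1 else 0)"
    and eig: "\<And>j a. j < n \<Longrightarrow> a < n \<Longrightarrow> (\<Sum>b<n. graph_laplacian G $$ (a, b) * w j b) = \<nu> j * w j a"
  proof (rule symmetric_eigenbasis_extension[of n "\<lambda>a b. graph_laplacian G $$ (a, b)" t
        "\<lambda>j. indicator_vector (Suc j)" "\<lambda>_. 0"])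
    show "(\<Sum>a<n. indicator_vector (Suc i) a * indicator_vector (Suc j) a) = (if i = j then 1 else 0)"
      if "i < t" "j < t" for i j
      using that indicator_vector_orthonormal[of "Suc i" "Suc j"] by simp
    show "(\<Sum>b<n. graph_laplacian G $$ (a, b) * indicator_vector (Suc j) b) =
        0 * indicator_vector (Suc j) a" if "j < t" "a < n" for j a
      using that indicator_vector_kernel[of "Suc j" a] by simp
  qed ((rule sym components_le; assumption) | (rule components_le) | (rule that; assumption))+
  have "\<nu> j \<noteq> 0" if j: "j < n" "t \<le> j" for j
  proof
    assume "\<nu> j = 0"
    then have edge: "w j u = w j v" if "(u, v) \<in> parcs G" for u v
      using eig[OF j(1)] that by (intro real_laplacian_kernel) auto
    have "w j a = 0" if a: "a < n" for a
    proof -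
      obtain i where i: "i \<in> {1..t}" "a \<in> block ns i" by (rule block_exists[OF a])
      then have pred: "i - 1 < t" "Suc (i - 1) = i" by auto
      then have "0 = (\<Sum>b<n. w (i - 1) b * w j b)"
        using j orth[of "i - 1" j] by simp
      also have "\<dots> = (\<Sum>b<n. if b \<in> block ns i then coefficient i * w j a else 0)"
      proof (rule sum.cong)
        fix b
        have "w (i - 1) = indicator_vector i"
          using w(1)[OF pred(1)] unfolding pred(2) .
        moreover have "w j b = w j a" if "b \<in> block ns i"
          using i(1) that i(2) edge by (rule block_constant)
        ultimately show "w (i - 1) b * w j b = (if b \<in> block ns i then coefficient i * w j a else 0)"
          by (simp add: indicator_vector_def)
      qed simp
      also have "\<dots> = real (ns i) * (coefficient i * w j a)"
        using i(1) by (simp only: sum_block) simp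
      finally show ?thesis
        using block_size_pos[OF i(1)] coefficient_pos[OF i(1)] by simp
    qed
    with orth[OF j(1) j(1)] show False by simp
  qed
  with w(2) have "\<nu> j = 0 \<longleftrightarrow> j < t" if "j < n" for j
    using that by (cases "j < t") auto
  with orth eig show thesis by (rule that)
qed

text \<open>The unitary matrix is \<open>Y * R\<close> with \<open>R\<close> the image of a real
  orthogonal eigenbasis: \<open>Y\<close> switches \<open>L\<close> to the graph Laplacian, and
  \<open>R\<close> diagonalizes that.\<close>

lemma eigenvalue_multiplicity_zero:
  fixes \<phi> :: "nat \<times> nat \<Rightarrow> 'a :: gain_scalar dual"
  assumes unit: "\<And>j. j < n \<Longrightarrow> conjugate (\<theta> j) * \<theta> j = 1"
    and switch: "conj_transpose (mat_diag n \<theta>) * gain_laplacian G \<phi> * mat_diag n \<theta> = graph_laplacian G"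
  shows "eigenvalue_multiplicity (gain_laplacian G \<phi>) 0 t"
proof -
  obtain w :: "nat \<Rightarrow> nat \<Rightarrow> real" and \<nu> where
    orth: "\<And>i j. i < n \<Longrightarrow> j < n \<Longrightarrow> (\<Sum>a<n. w i a * w j a) = (if i = j then 1 else 0)"
    and eig: "\<And>j a. j < n \<Longrightarrow> a < n \<Longrightarrow> (\<Sum>b<n. graph_laplacian G $$ (a, b) * w j b) = \<nu> j * w j a"
    and zero: "\<And>j. j < n \<Longrightarrow> \<nu> j = 0 \<longleftrightarrow> j < t"
    by (rule real_eigenbasis) (rule that)
  interpret h: semiring_hom "real_dual :: real \<Rightarrow> 'a dual"
    by standard (simp_all add: real_dual_def dual_eq_iff)
  define A :: "real mat" where "A = graph_laplacian G"
  define Q where "Q = mat n n (\<lambda>(a, k). w k a)"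
  have A: "A \<in> carrier_mat n n" by (simp add: A_def graph_laplacian_eq)
  have Q: "Q \<in> carrier_mat n n" "Q\<^sup>T \<in> carrier_mat n n" by (simp_all add: Q_def)
  have QQ: "Q\<^sup>T * Q = 1\<^sub>m n"
    by (rule eq_matI) (auto simp: Q_def scalar_prod_def orth lessThan_atLeast0[symmetric])
  \<comment> \<open>Over a field a left inverse of a square matrix is a right inverse, so this half
    is settled before passing to dual scalars.\<close>
  then have QQ': "Q * Q\<^sup>T = 1\<^sub>m n"
    using Q by (intro mat_mult_left_right_inverse[of "Q\<^sup>T"])
  have AQ: "A * Q = Q * mat_diag n \<nu>"
    unfolding mat_diag_mult_right[OF Q(1)]
  proof (rule eq_matI)
    fix a k assume "a < dim_row (mat n n (\<lambda>(i, j). Q $$ (i, j) * \<nu> j))"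
      "k < dim_col (mat n n (\<lambda>(i, j). Q $$ (i, j) * \<nu> j))"
    then have ak: "a < n" "k < n" by simp_all
    have "(A * Q) $$ (a, k) = (\<Sum>b<n. graph_laplacian G $$ (a, b) * w k b)"
      using ak A by (auto simp: A_def Q_def scalar_prod_def lessThan_atLeast0 intro!: sum.cong)
    with ak eig[OF ak(2,1)]
    show "(A * Q) $$ (a, k) = mat n n (\<lambda>(i, j). Q $$ (i, j) * \<nu> j) $$ (a, k)"
      by (simp add: Q_def mult.commute)
  qed (use A Q in auto)
  have diag: "Q\<^sup>T * A * Q = mat_diag n \<nu>"
    using A Q QQ by (simp add: AQ left_mult_one_mat[of _ n n] assoc_mult_mat[of _ n n _ n _ n] flip: assoc_mult_mat[of "Q\<^sup>T" n n Q n _ n])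

  define R :: "'a dual mat" where "R = map_mat real_dual Q"
  have R: "R \<in> carrier_mat n n" using Q by (simp add: R_def)
  \<comment> \<open>Entries with real coefficients are fixed by conjugation, so only the
    transposition remains.\<close>
  have R': "conj_transpose R = map_mat real_dual (Q\<^sup>T)"
    using Q by (auto simp: conj_transpose_def R_def real_dual_def intro!: eq_matI)
  then have Rc: "conj_transpose R \<in> carrier_mat n n" using Q by simp
  have RR: "conj_transpose R * R = 1\<^sub>m n" "R * conj_transpose R = 1\<^sub>m n"
    unfolding R' unfolding R_def using Q QQ QQ'
    by (simp_all add: h.mat_hom_one flip: h.mat_hom_mult[of _ n n _ n])
  have LA: "graph_laplacian G = (map_mat real_dual A :: 'a dual mat)"
    unfolding A_def graph_laplacian_eq
    by (rule eq_matI)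
      (auto simp: gain_laplacian_index dual_of_nat real_dual_def dual_eq_iff)
  have RLR: "conj_transpose R * graph_laplacian G * R = mat_diag n (\<lambda>k. real_dual (\<nu> k))"
  proof -
    have "conj_transpose R * graph_laplacian G * R = map_mat real_dual (Q\<^sup>T * A * Q)"
      unfolding R' LA unfolding R_def using A Q
      by (simp add: h.mat_hom_mult[of _ n n _ n])
    also have "\<dots> = mat_diag n (\<lambda>k. real_dual (\<nu> k))"
      unfolding diag by (rule eq_matI) (auto simp: mat_diag_def)
    finally show ?thesis .
  qed

  define Y where "Y = mat_diag n \<theta>"
  define L where "L = gain_laplacian G \<phi>"
  have Y: "Y \<in> carrier_mat n n" "conj_transpose Y \<in> carrier_mat n n"
    and L: "L \<in> carrier_mat n n"
    by (simp_all add: Y_def L_def conj_transpose_def mat_diag_def)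
  have ct: "conj_transpose Y = mat_diag n (\<lambda>j. conjugate (\<theta> j))"
    unfolding Y_def
    by (auto simp: conj_transpose_def mat_diag_def conjugate_dual_arith intro!: eq_matI)
  have YY: "conj_transpose Y * Y = 1\<^sub>m n" "Y * conj_transpose Y = 1\<^sub>m n"
    unfolding ct unfolding Y_def mat_diag_diag
    using unit dual_left_inverse_right_inverse[OF unit]
    by (auto simp: mat_diag_def intro!: eq_matI)
  define U where "U = Y * R"
  have U: "U \<in> carrier_mat n n" using Y R by (simp add: U_def)
  have Uc: "conj_transpose U = conj_transpose R * conj_transpose Y"
    unfolding U_def using Y R by (intro conj_transpose_mult)
  note assoc = assoc_mult_mat[of _ n n _ n _ n]
  have "conj_transpose U * U = conj_transpose R * ((conj_transpose Y * Y) * R)"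
    unfolding Uc unfolding U_def using Y R Rc by (simp add: assoc)
  also have "\<dots> = 1\<^sub>m n" using R by (simp add: YY RR)
  finally have UU: "conj_transpose U * U = 1\<^sub>m n" .
  have "U * conj_transpose U = Y * ((R * conj_transpose R) * conj_transpose Y)"
    unfolding Uc unfolding U_def using Y R Rc by (simp add: assoc)
  also have "\<dots> = 1\<^sub>m n" using Y by (simp add: YY RR)
  finally have UU': "U * conj_transpose U = 1\<^sub>m n" .
  have "conj_transpose U * L * U = conj_transpose R * (conj_transpose Y * L * Y) * R"
    unfolding Uc unfolding U_def using Y R Rc L by (simp add: assoc)
  also have "\<dots> = mat_diag n (\<lambda>k. real_dual (\<nu> k))"
    unfolding Y_def L_def switch RLR ..
  finally have ULU: "conj_transpose U * L * U = mat_diag n (\<lambda>k. real_dual (\<nu> k))" .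

  define \<Lambda> where "\<Lambda> = map (\<lambda>k. Dual (\<nu> k) 0) [0..<n]"
  have "mat_diag n (\<lambda>k. real_dual (\<nu> k)) = (mat_diag n (\<lambda>i. of_dual (\<Lambda> ! i)) :: 'a dual mat)"
    by (rule eq_matI) (auto simp: mat_diag_def \<Lambda>_def real_dual_def)
  then have "eigenvalue_list L \<Lambda>"
    unfolding eigenvalue_list_def Let_def using U UU UU' ULU L by (auto simp: \<Lambda>_def)
  moreover have "count_list \<Lambda> 0 = t"
  proof -
    have "count_list \<Lambda> 0 = card ({k. 0 = Dual (\<nu> k) 0} \<inter> {0..<n})"
      by (simp add: \<Lambda>_def count_list_eq_length_filter filter_map o_def distinct_length_filter)
    also have "{k. 0 = Dual (\<nu> k) 0} \<inter> {0..<n} = {0..<t}"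
      using zero components_le by (auto simp: zero_dual_def)
    finally show ?thesis by simp
  qed
  ultimately show ?thesis unfolding eigenvalue_multiplicity_def L_def by blast
qed

section \<open>The two implications\<close>

lemma component_sum:
  assumes "eigenvector_condition (gain_laplacian G \<phi>) t ns x"
    and i: "i \<in> {1..t}" "j \<in> block ns i"
  shows "(\<Sum>k = 1..t. x k $ j) = x i $ j"
proof -
  have "j < n" using block_subset i by fastforce
  \<comment> \<open>Outside the block the magnitude is 0 as a dual number, which forces the
    infinitesimal part of the entry to vanish as well.\<close>
  have "x k $ j = 0" if "k \<in> {1..t}" "k \<noteq> i" for k
  proof -
    have "j \<notin> block ns k"
      using block_disjoint[OF that(1) i(1) _ i(2)] that(2) by blast
    then have "magnitude (x k $ j) = 0"
      using assms(1) that(1) \<open>j < n\<close> by (simp add: eigenvector_condition_def)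
    then show ?thesis by (simp only: magnitude_eq_zero_iff)
  qed
  then have "(\<Sum>k = 1..t. x k $ j) = (\<Sum>k = 1..t. if k = i then x i $ j else 0)"
    by (intro sum.cong) auto
  then show ?thesis using i(1) by simp
qed

lemma conditions_imp_balanced:
  fixes \<phi> :: "nat \<times> nat \<Rightarrow> 'a :: gain_scalar dual"
  assumes ev: "eigenvector_condition (gain_laplacian G \<phi>) t ns x"
    and sw: "switching_condition G (gain_laplacian G \<phi>) t x"
  shows "balanced G \<phi>"
proof -
  define xa where "xa = (\<lambda>j. \<Sum>i = 1..t. x i $ j)"
  define y where "y = (\<lambda>j. xa j / of_dual (magnitude (xa j)))"
  \<comment> \<open>The blocks cover all vertices, so condition (ii) gives every entry of
    \<open>xa\<close> a positive real magnitude, and its normalization is a unit.\<close>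
  have unit: "conjugate (y j) * y j = 1" if j: "j < n" for j
  proof -
    obtain i where i: "i \<in> {1..t}" "j \<in> block ns i" by (rule block_exists[OF j])
    have "magnitude (xa j) = Dual (coefficient i) 0"
      using ev i j unfolding xa_def component_sum[OF ev i]
      by (auto simp: eigenvector_condition_def coefficient_def)
    then show ?thesis
      unfolding y_def by (rule normalized_dual) (rule coefficient_pos[OF i(1)])
  qed
  have "mat_diag n (\<lambda>j. vec n xa $ j / of_dual (magnitude (vec n xa $ j))) = mat_diag n y"
    by (auto simp: mat_diag_def y_def intro!: eq_matI)
  then have "conj_transpose (mat_diag n y) * gain_laplacian G \<phi> * mat_diag n y = graph_laplacian G"
    using sw by (simp add: switching_condition_def Let_def xa_def)
  then have "conjugate (y u) * \<phi> (u, v) * y v = 1" if "(u, v) \<in> parcs G" for u v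
    using that by (simp add: switching_iff_potential[OF unit])
  then show ?thesis
    using unit verts_eq by (intro potential_imp_balanced[of G y] pair_graph) auto
qed

lemma balanced_imp_conditions:
  fixes \<phi> :: "nat \<times> nat \<Rightarrow> 'a :: gain_scalar dual"
  assumes ug: "unit_gain_graph G \<phi>" and bal: "balanced G \<phi>"
  shows "zero_eigenvalue_condition (gain_laplacian G \<phi>) t"
    and "\<exists>x. eigenvector_condition (gain_laplacian G \<phi>) t ns x \<and>
      switching_condition G (gain_laplacian G \<phi>) t x"
proof -
  obtain \<theta> where \<theta>: "\<And>v. v \<in> pverts G \<Longrightarrow> conjugate (\<theta> v) * \<theta> v = 1"
    and pot: "\<And>u v. (u, v) \<in> parcs G \<Longrightarrow> conjugate (\<theta> u) * \<phi> (u, v) * \<theta> v = 1"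
    by (rule balanced_potential[OF ug bal]) (rule that)
  have unit: "conjugate (\<theta> j) * \<theta> j = 1" if "j < n" for j
    using \<theta> that by (simp add: verts_eq)
  have unit': "\<theta> j * conjugate (\<theta> j) = 1" if "j < n" for j
    using unit[OF that] by (rule dual_left_inverse_right_inverse)
  have switch: "conj_transpose (mat_diag n \<theta>) * gain_laplacian G \<phi> * mat_diag n \<theta> = graph_laplacian G"
    using pot by (simp add: switching_iff_potential[OF unit])
  have edge: "\<phi> (u, v) * \<theta> v = \<theta> u" if uv: "(u, v) \<in> parcs G" for u v
  proof -
    have "\<theta> u * (conjugate (\<theta> u) * \<phi> (u, v) * \<theta> v) = \<theta> u"
      by (simp add: pot[OF uv])
    then show ?thesis
      using unit'[of u] arc_less[OF uv] by (simp flip: mult.assoc)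
  qed
  \<comment> \<open>The normalized indicators span the kernel of the graph Laplacian; multiplication
    by the potential carries them to kernel vectors of \<open>L\<close>.\<close>
  define x where "x = (\<lambda>i. vec n (\<lambda>j. \<theta> j * of_dual (Dual (indicator_vector i j) 0)))"
  have mag: "magnitude (\<theta> j * of_dual (Dual r 0)) = Dual r 0" if "j < n" "0 < r" for j r
  proof -
    have "\<theta> j * of_dual (Dual r 0) * conjugate (\<theta> j * of_dual (Dual r 0)) =
        of_dual (Dual r 0) * 1 * of_dual (Dual r 0)"
      by (simp only: mult_conjugate_scaled unit'[OF that(1)])
    also have "\<dots> = of_dual (Dual (r\<^sup>2) 0)"
      by (simp add: dual_eq_iff power2_eq_square)
    finally show ?thesis by (simp only: magnitude_eq_real_iff[OF that(2)])
  qed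
  have ev: "right_eigenvector (gain_laplacian G \<phi>) (x i) 0" if i: "i \<in> {1..t}" for i
  proof -
    obtain j where j: "j \<in> block ns i"
      using block_nonempty[OF i] by blast
    then have "j < n" using block_subset[OF i] by auto
    then have "std_part (\<theta> j) \<noteq> 0"
      using arg_cong[OF unit, of j std_part] by auto
    then have "std_part (x i $ j) \<noteq> 0"
      using j \<open>j < n\<close> coefficient_pos[OF i] by (simp add: x_def indicator_vector_def)
    moreover have "gain_laplacian G \<phi> *\<^sub>v x i = map_vec (\<lambda>a. a * 0) (x i)"
    proof (rule eq_vecI)
      fix u assume "u < dim_vec (map_vec (\<lambda>a. a * 0) (x i))"
      then have u: "u < n" by (simp add: x_def)
      have x: "x i \<in> carrier_vec n" by (simp add: x_def)
      have "x i $ u = \<phi> (u, v) * x i $ v" if uv: "(u, v) \<in> parcs G" for v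
      proof -
        have "indicator_vector i u = indicator_vector i v"
          using arc_block_iff[OF uv i] by (simp add: indicator_vector_def)
        then show ?thesis
          using edge[OF uv] arc_less[OF uv] by (simp add: x_def flip: mult.assoc)
      qed
      then have "(gain_laplacian G \<phi> *\<^sub>v x i) $ u = 0"
        unfolding gain_laplacian_mult_vec[OF u x] by (intro sum.neutral) auto
      then show "(gain_laplacian G \<phi> *\<^sub>v x i) $ u = map_vec (\<lambda>a. a * 0) (x i) $ u"
        using u by (simp add: x_def)
    qed (simp add: x_def)
    ultimately show ?thesis
      using \<open>j < n\<close> by (auto simp: right_eigenvector_def x_def)
  qed
  have mag_x: "magnitude (x i $ j) = (if j \<in> block ns i then Dual (coefficient i) 0 else 0)"
    if "i \<in> {1..t}" "j < n" for i j
  proof (cases "j \<in> block ns i")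
    case True
    with that mag[OF that(2) coefficient_pos[OF that(1)]] show ?thesis
      by (simp add: x_def indicator_vector_def)
  next
    case False
    with that show ?thesis
      by (simp add: x_def indicator_vector_def magnitude_def dual_eq_iff)
  qed
  then have cond: "eigenvector_condition (gain_laplacian G \<phi>) t ns x"
    using ev by (simp add: eigenvector_condition_def coefficient_def)
  \<comment> \<open>Normalization removes the positive real factor, so the matrix built from these
    eigenvectors is the diagonal matrix of \<open>\<theta>\<close>, and condition (iii) is the
    identity \<open>switch\<close>.\<close>
  have "(\<Sum>i = 1..t. x i $ j) / of_dual (magnitude (\<Sum>i = 1..t. x i $ j)) = \<theta> j" if j: "j < n" for j
  proof -
    obtain i where i: "i \<in> {1..t}" "j \<in> block ns i" by (rule block_exists[OF j])
    let ?c = "of_dual (Dual (coefficient i) 0) :: 'a dual"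
    have "?c * inverse ?c = 1"
      using coefficient_pos[OF i(1)] by (intro dual_inverse) simp
    moreover have "x i $ j = \<theta> j * ?c"
      using i j by (simp add: x_def indicator_vector_def)
    ultimately show ?thesis
      unfolding component_sum[OF cond i] mag_x[OF i(1) j]
      using i(2) by (simp add: divide_dual_def mult.assoc)
  qed
  then have "mat_diag n (\<lambda>j. vec n (\<lambda>j. \<Sum>i = 1..t. x i $ j) $ j /
      of_dual (magnitude (vec n (\<lambda>j. \<Sum>i = 1..t. x i $ j) $ j))) = mat_diag n \<theta>"
    by (auto simp: mat_diag_def intro!: eq_matI)
  then have "switching_condition G (gain_laplacian G \<phi>) t x"
    by (simp only: switching_condition_def Let_def dim_gain_laplacian switch)
  with cond show "\<exists>x. eigenvector_condition (gain_laplacian G \<phi>) t ns x \<and>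
      switching_condition G (gain_laplacian G \<phi>) t x"
    by blast
  have "right_eigenvalue (gain_laplacian G \<phi>) (of_dual 0)"
    using ev[of 1] components_pos by (auto simp: right_eigenvalue_def of_dual_arith)
  then have "smallest_eigenvalue (gain_laplacian G \<phi>) 0"
    using right_eigenvalue_nonneg[OF ug] by (simp add: smallest_eigenvalue_def)
  with eigenvalue_multiplicity_zero[OF unit switch]
  show "zero_eigenvalue_condition (gain_laplacian G \<phi>) t"
    by (simp add: zero_eigenvalue_condition_def)
qed

text \<open>Generic in the scalar class, so that one proof covers real, complex and quaternionic
  coefficients.\<close>

theorem balanced_iff:
  fixes \<phi> :: "nat \<times> nat \<Rightarrow> 'a :: gain_scalar dual"
  assumes "unit_gain_graph G \<phi>"
  shows "balanced G \<phi> \<longleftrightarrow>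
    zero_eigenvalue_condition (gain_laplacian G \<phi>) t \<and>
    (\<exists>x. eigenvector_condition (gain_laplacian G \<phi>) t ns x \<and>
         switching_condition G (gain_laplacian G \<phi>) t x)"
  using balanced_imp_conditions[OF assms] conditions_imp_balanced by blast

end

theorem theorem6p1:
  fixes G :: "nat pair_pre_digraph" and n t :: nat and ns :: "nat \<Rightarrow> nat"
  assumes "pair_graph G" and "n \<ge> 1" and "pverts G = {0..<n}"
    and "ns 0 = 0" and "n = (\<Sum>i = 1..t. ns i)"
    and components: "card (pre_digraph.sccs_verts (with_proj G)) = t"
      "pre_digraph.sccs_verts (with_proj G) = block ns ` {1..t}"
  shows
    "(\<forall>\<phi> :: nat \<times> nat \<Rightarrow> real dual. unit_gain_graph G \<phi> \<longrightarrow>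
        (balanced G \<phi> \<longleftrightarrow>
          zero_eigenvalue_condition (gain_laplacian G \<phi>) t \<and>
          (\<exists>x. eigenvector_condition (gain_laplacian G \<phi>) t ns x \<and>
               switching_condition G (gain_laplacian G \<phi>) t x))) \<and>
     (\<forall>\<phi> :: nat \<times> nat \<Rightarrow> complex dual. unit_gain_graph G \<phi> \<longrightarrow>
        (balanced G \<phi> \<longleftrightarrow>
          zero_eigenvalue_condition (gain_laplacian G \<phi>) t \<and>
          (\<exists>x. eigenvector_condition (gain_laplacian G \<phi>) t ns x \<and>
               switching_condition G (gain_laplacian G \<phi>) t x))) \<and>
     (\<forall>\<phi> :: nat \<times> nat \<Rightarrow> quat dual. unit_gain_graph G \<phi> \<longrightarrow>
        (balanced G \<phi> \<longleftrightarrow>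
          zero_eigenvalue_condition (gain_laplacian G \<phi>) t \<and>
          (\<exists>x. eigenvector_condition (gain_laplacian G \<phi>) t ns x \<and>
               switching_condition G (gain_laplacian G \<phi>) t x)))"
proof -
  interpret pair_graph G by fact
  interpret block_graph G n t ns
    using assms by unfold_locales auto
  show ?thesis by (intro conjI allI impI balanced_iff)
qed

end
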